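(* Let $d\ge1$, let $\|\cdot\|$ be a norm on $\mathbb{R}^d$ with positive unit sphere $S_+=\{s\in[0,\infty)^d:\|s\|=1\}$, and let $H_\ell$ be a finite Borel measure on $S_+$ with $\int_{S_+}s_j\,H_\ell(ds)=1$ for $j=1,\dots,d$. Put $$\ell(z):=\int_{S_+}\max_{1\le j\le d}s_jz_j\,H_\ell(ds),\qquad z\in[0,\infty)^d,$$ and, for $\alpha>0$, let $F_\alpha$ be the max-stable distribution function with unit-$\alpha$-Fréchet margins given by $$F_\alpha(x):=\exp\{-\ell(x_1^{-\alpha},\dots,x_d^{-\alpha})\},\qquad x\in(0,\infty)^d.$$ Let $\alpha_1,\alpha_2>0$, $\alpha_*:=\min(\alpha_1,\alpha_2)$, and $$\eta(\alpha_1,\alpha_2):=\sup_{q>0}\left|e^{-q^{\alpha_1}}-e^{-q^{\alpha_2}}\right|.$$ (i) The Kolmogorov distance satisfies $$\eta(\alpha_1,\alpha_2)\le\mathrm d_K(F_{\alpha_1},F_{\alpha_2})\le1\wedge d\,\eta(\alpha_1,\alpha_2).$$ Moreover, if $C_0:=\sup_{z>0}ze^{-z}|\log z|$, then $$\mathrm d_K(F_{\alpha_1},F_{\alpha_2})\le1\wedge\frac{dC_0}{\alpha_*}|\alpha_1-\alpha_2|.$$ (ii) If $\alpha_1,\alpha_2>1$, then $$W_{1,\|\cdot\|_1}\bigl(F_{\alpha_1},F_{\alpha_2}\bigr)=d\int_0^\infty\left|t^{-1/\alpha_1}-t^{-1/\alpha_2}\right|e^{-t}\,dt.$$ (iii)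 For $1\le p<\alpha_*$, $$W_{p,\|\cdot\|_1}\bigl(F_{\alpha_1},F_{\alpha_2}\bigr)\le d\,m_p\Bigl(\frac1{\alpha_1},\frac1{\alpha_2}\Bigr),\qquad m_p(\beta_1,\beta_2):=\left(\int_0^\infty\left|t^{-\beta_1}-t^{-\beta_2}\right|^pe^{-t}\,dt\right)^{1/p}.$$
   Context: $a\wedge b=\min(a,b)$; $\|x\|_1=\sum_j|x_j|$. Unit-$\alpha$-Fréchet margins means each margin is $x\mapsto\exp\{-x^{-\alpha}\}$ for $x>0$; accordingly $F_\alpha(x)=0$ if some coordinate of $x$ is non-positive. Kolmogorov distance: $\mathrm d_K(F,G)=\sup_{x\in\mathbb{R}^d}|F(x)-G(x)|$. Wasserstein distance: for $p\ge1$ and laws $\mu,\nu$ on $\mathbb{R}^d$ with finite $p$-th moment, $W_{p,\|\cdot\|_1}(\mu,\nu)=\inf_\pi(\int\|x-y\|_1^p\,\pi(dx,dy))^{1/p}$, the infimum being over all couplings $\pi$ of $\mu$ and $\nu$; for distribution functions, it denotes the distance between the corresponding laws. *)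

theory Defs
  imports "HOL-Probability.Probability"
begin

definition is_norm :: "('a::real_vector \<Rightarrow> real) \<Rightarrow> bool" where
  "is_norm N \<longleftrightarrow>
     (\<forall>x. 0 \<le> N x) \<and>
     (\<forall>x. N x = 0 \<longleftrightarrow> x = 0) \<and>
     (\<forall>c x. N (c *\<^sub>R x) = \<bar>c\<bar> * N x) \<and>
     (\<forall>x y. N (x + y) \<le> N x + N y)"

definition pos_sphere :: "(real ^ 'd \<Rightarrow> real) \<Rightarrow> (real ^ 'd) set" where
  "pos_sphere N = {s. (\<forall>j. 0 \<le> s $ j) \<and> N s = 1}"

(* The function l(z), for z in the nonnegative orthant. *)
definition stdf :: "(real ^ 'd::finite) measure \<Rightarrow> real ^ 'd \<Rightarrow> real" where
  "stdf H z = (\<integral>s. (MAX j. s $ j * z $ j) \<partial>H)"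

definition max_stable_df :: "(real ^ 'd::finite) measure \<Rightarrow> real \<Rightarrow> real ^ 'd \<Rightarrow> real" where
  "max_stable_df H \<alpha> x =
     (if \<forall>j. 0 < x $ j then exp (- stdf H (\<chi> j. x $ j powr (- \<alpha>))) else 0)"

definition kolmogorov_dist :: "(real ^ 'd \<Rightarrow> real) \<Rightarrow> (real ^ 'd \<Rightarrow> real) \<Rightarrow> real" where
  "kolmogorov_dist F G = (SUP x. \<bar>F x - G x\<bar>)"

(* The order on real ^ 'd is componentwise, so {..x} is a lower-left orthant. *)
definition is_law_of :: "(real ^ 'd::finite) measure \<Rightarrow> (real ^ 'd \<Rightarrow> real) \<Rightarrow> bool" where
  "is_law_of \<mu> F \<longleftrightarrow> prob_space \<mu> \<and> sets \<mu> = sets borel \<and> (\<forall>x. measure \<mu> {..x} = F x)"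

(* A law is determined by its distribution function, so the description is
   meaningful exactly when F is a distribution function. *)
definition law_of :: "(real ^ 'd::finite \<Rightarrow> real) \<Rightarrow> (real ^ 'd) measure" where
  "law_of F = (THE \<mu>. is_law_of \<mu> F)"

definition l1_norm :: "real ^ 'd::finite \<Rightarrow> real" where
  "l1_norm x = (\<Sum>j\<in>UNIV. \<bar>x $ j\<bar>)"

definition couplings ::
  "(real ^ 'd::finite) measure \<Rightarrow> (real ^ 'd) measure \<Rightarrow> ((real ^ 'd) \<times> (real ^ 'd)) measure set" where
  "couplings \<mu> \<nu> =
     {\<pi>. prob_space \<pi> \<and> sets \<pi> = sets borel \<and> distr \<pi> borel fst = \<mu> \<and> distr \<pi> borel snd = \<nu>}"

(* x to the power 1/p, with the power of infinity being infinity. *)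
definition ennreal_root :: "real \<Rightarrow> ennreal \<Rightarrow> ennreal" where
  "ennreal_root p x = (if x = \<infinity> then \<infinity> else ennreal (enn2real x powr (1 / p)))"

(* Extended-valued, so that a coupling of infinite cost does not contribute 0
   to the infimum; the value is finite for laws with finite p-th moment. *)
definition wasserstein_l1 ::
  "real \<Rightarrow> (real ^ 'd::finite) measure \<Rightarrow> (real ^ 'd) measure \<Rightarrow> ennreal" where
  "wasserstein_l1 p \<mu> \<nu> =
     (INF \<pi>\<in>couplings \<mu> \<nu>.
        ennreal_root p (\<integral>\<^sup>+(x, y). ennreal (l1_norm (x - y) powr p) \<partial>\<pi>))"

definition eta :: "real \<Rightarrow> real \<Rightarrow> real" where
  "eta \<alpha>1 \<alpha>2 = (SUP q\<in>{0<..}. \<bar>exp (- (q powr \<alpha>1)) - exp (- (q powr \<alpha>2))\<bar>)"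

definition C0 :: real where
  "C0 = (SUP z\<in>{0<..}. z * exp (- z) * \<bar>ln z\<bar>)"

definition m_exp :: "real \<Rightarrow> real \<Rightarrow> real \<Rightarrow> real" where
  "m_exp p \<beta>1 \<beta>2 =
     (LBINT t:{0<..}. \<bar>t powr (- \<beta>1) - t powr (- \<beta>2)\<bar> powr p * exp (- t)) powr (1 / p)"

end

theory Submission
  imports Defs
begin

text \<open>
  Everything rests on one random vector \<open>Z\<close> with distribution function \<open>F\<^sub>1\<close>: for every
  \<open>\<alpha> > 0\<close>, the vector of the powers \<open>Z\<^sub>j powr (1 / \<alpha>)\<close> has distribution function
  \<open>F\<^sub>\<alpha>\<close>, so that all the laws live on one probability space (lemma \<open>law_of_max_stable_df\<close>).

  The vector \<open>Z\<close> is built as in de Haan's representation. Points \<open>s / w\<close> with \<open>(s, w)\<close>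
  distributed according to \<open>H\<close> times Lebesgue measure are arranged in layers
  \<open>k < w \<le> k + 1\<close>, each of finite mass. In a layer the maximum of a Poisson number of
  independent points has an explicit distribution function, and \<open>Z\<close> is the supremum of
  independent maxima of this kind, one for each layer. The exponents telescope to the integrals of the
  truncations of \<open>max\<^sub>j (s\<^sub>j / x\<^sub>j)\<close>, which converge to the exponent of \<open>F\<^sub>1\<close>
  (lemma \<open>exists_simple_max_stable_law\<close>). Since \<open>z\<^sub>j \<le> \<ell>(z) \<le> (\<Sum>i. z\<^sub>i)\<close>, the margins are
  unit Frechet, that is, \<open>1 / Z\<^sub>j\<close> is standard exponential.

  For the Kolmogorov distance, \<open>F\<^sub>\<alpha>(x)\<close> is the probability that \<open>Z\<^sub>j \<le> x\<^sub>j powr \<alpha>\<close> for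
  all \<open>j\<close>; two such events differ only if some \<open>Z\<^sub>j\<close> lies between the two thresholds, which
  gives the factor \<open>d\<close>. The lower bound comes from the margins, and the bound with \<open>C\<^sub>0\<close> from
  the mean value theorem in \<open>\<alpha>\<close>.

  For the Wasserstein distance, the coupling of the powers of \<open>Z\<close> gives the upper bound. For
  \<open>p = 1\<close> it is optimal: both powers of \<open>Z\<^sub>j\<close> lie on the same side of \<open>1\<close>, so that
  \<open>\<bar>X\<^sub>j - Y\<^sub>j\<bar>\<close> equals, up to a fixed sign, \<open>\<bar>X\<^sub>j - 1\<bar> - \<bar>Y\<^sub>j - 1\<bar>\<close>. The expectation of the
  latter depends only on the margins, and by the triangle inequality it bounds the cost of
  every coupling from below (lemma \<open>coupling_coordinate_cost_ge\<close>).
\<close>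

section \<open>Laws on real vectors and their distribution functions\<close>

lemma borel_measurable_vec_iff:
  fixes f :: "'a \<Rightarrow> real ^ 'd::finite"
  shows "f \<in> borel_measurable M \<longleftrightarrow> (\<forall>j. (\<lambda>x. f x $ j) \<in> borel_measurable M)"
proof -
  have "(\<forall>i\<in>Basis. (\<lambda>x. f x \<bullet> i) \<in> borel_measurable M)
      \<longleftrightarrow> (\<forall>j. (\<lambda>x. f x \<bullet> axis j 1) \<in> borel_measurable M)"
    by (auto simp: Basis_vec_def)
  then show ?thesis
    by (subst borel_measurable_euclidean_space) (simp add: inner_axis)
qed

lemma borel_measurable_vec_nth [measurable]:
  "(\<lambda>x. x $ j) \<in> borel_measurable (borel :: (real ^ 'd::finite) measure)"
  using borel_measurable_vec_iff[of "\<lambda>x. x" borel] by simp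

lemma measurable_vec_nth_compose [measurable (raw)]:
  fixes f :: "'a \<Rightarrow> real ^ 'd::finite"
  shows "f \<in> borel_measurable M \<Longrightarrow> (\<lambda>x. f x $ j) \<in> borel_measurable M"
  by (simp add: borel_measurable_vec_iff)

lemma measurable_vec_lambda [measurable (raw)]:
  fixes f :: "'d::finite \<Rightarrow> 'a \<Rightarrow> real"
  shows "(\<And>j. f j \<in> borel_measurable M) \<Longrightarrow> (\<lambda>x. \<chi> j. f j x) \<in> borel_measurable M"
  by (simp add: borel_measurable_vec_iff)

lemma law_unique:
  assumes "is_law_of \<mu> F" "is_law_of \<nu> F"
  shows "\<mu> = \<nu>"
proof -
  interpret M: prob_space \<mu> using assms by (simp add: is_law_of_def)
  interpret N: prob_space \<nu> using assms by (simp add: is_law_of_def)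
  have sets: "sets \<mu> = sets borel" "sets \<nu> = sets borel"
    using assms by (simp_all add: is_law_of_def)
  have gen: "sets (borel :: (real ^ 'd) measure) = sigma_sets UNIV (range atMost)"
    by (subst borel_eq_atMost) (rule sets_measure_of, simp)
  show ?thesis
  proof (rule measure_eqI_generator_eq[of "range atMost" UNIV \<mu> \<nu> "\<lambda>n. {..(\<chi> j. real n)}"])
    show "Int_stable (range atMost :: (real ^ 'd) set set)"
    proof (rule Int_stableI)
      fix a b :: "(real ^ 'd) set" assume "a \<in> range atMost" "b \<in> range atMost"
      then obtain u v where "a = {..u}" "b = {..v}" by auto
      then have "a \<inter> b = {..(\<chi> j. min (u $ j) (v $ j))}"
        by (auto simp: less_eq_vec_def)
      then show "a \<inter> b \<in> range atMost" by blast
    qed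
    show "emeasure \<mu> X = emeasure \<nu> X" if X: "X \<in> range atMost" for X
      using that assms unfolding is_law_of_def M.emeasure_eq_measure N.emeasure_eq_measure
      by auto
    show "(\<Union>n. {..(\<chi> j. real n) :: real ^ 'd}) = UNIV"
    proof (intro equalityI subsetI UNIV_I)
      fix z :: "real ^ 'd"
      obtain n where "norm z \<le> real n" using real_arch_simple by blast
      then have "z $ j \<le> real n" for j
        using component_le_norm_cart[of z j] by linarith
      then show "z \<in> (\<Union>n. {..(\<chi> j. real n)})" by (auto simp: less_eq_vec_def)
    qed
  qed (use sets gen in auto)
qed

lemma law_of_eqI: "is_law_of \<mu> F \<Longrightarrow> law_of F = \<mu>"
  unfolding law_of_def by (blast intro: law_unique)

section \<open>Maxima of a Poisson number of independent points\<close>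

text \<open>The law of the componentwise maximum of \<open>0\<close> and \<open>n\<close> independent points with law \<open>P\<close>.\<close>

primrec max_law :: "(real ^ 'd::finite) measure \<Rightarrow> nat \<Rightarrow> (real ^ 'd) measure" where
  "max_law P 0 = return borel 0"
| "max_law P (Suc n) =
     distr (max_law P n \<Otimes>\<^sub>M P) borel (\<lambda>p. \<chi> j. max (fst p $ j) (snd p $ j))"

lemma max_law:
  fixes P :: "(real ^ 'd::finite) measure"
  assumes P: "prob_space P" "sets P = sets borel"
  shows "prob_space (max_law P n) \<and> sets (max_law P n) = sets borel \<and>
    (\<forall>x. (\<forall>j. 0 \<le> x $ j) \<longrightarrow> measure (max_law P n) {..x} = measure P {..x} ^ n)"
proof (induction n)
  case 0
  show ?case
    by (auto simp: prob_space_return measure_return indicator_def less_eq_vec_def)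
next
  case (Suc n)
  let ?M = "max_law P n"
  let ?g = "\<lambda>p::(real^'d)\<times>(real^'d). (\<chi> j. max (fst p $ j) (snd p $ j)) :: real ^ 'd"
  interpret P: prob_space P by fact
  interpret M: prob_space ?M using Suc by simp
  interpret MP: pair_prob_space ?M P ..
  have [measurable_cong]: "sets ?M = sets borel" "sets P = sets borel"
    using Suc P by simp_all
  have sp: "space ?M = UNIV" "space P = UNIV"
    using Suc P sets_eq_imp_space_eq space_borel by metis+
  have g [measurable]: "?g \<in> borel_measurable (?M \<Otimes>\<^sub>M P)" by measurable
  have "prob_space (max_law P (Suc n))"
    by (simp add: MP.P.prob_space_distr)
  moreover have "measure (max_law P (Suc n)) {..x} = measure P {..x} ^ Suc n"
    if x: "\<forall>j. 0 \<le> x $ j" for x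
  proof -
    have "?g -` {..x} \<inter> space (?M \<Otimes>\<^sub>M P) = {..x} \<times> {..x}"
      by (auto simp: less_eq_vec_def space_pair_measure sp)
    then have "measure (max_law P (Suc n)) {..x} = measure (?M \<Otimes>\<^sub>M P) ({..x} \<times> {..x})"
      by (simp add: measure_distr)
    also have "\<dots> = measure ?M {..x} * measure P {..x}"
      by (simp add: measure_def P.emeasure_pair_measure_Times enn2real_mult)
    finally show ?thesis using Suc x by simp
  qed
  ultimately show ?case by simp
qed

text \<open>
  With a Poisson number of points the generating function turns the \<open>n\<close>-th powers into an
  exponential: \<open>c\<close> times the law \<open>P\<close> becomes the exponent measure of the maximum.
\<close>

lemma exists_poisson_max_law:
  fixes P :: "(real ^ 'd::finite) measure"
  assumes P: "prob_space P" "sets P = sets borel" and c: "0 < c"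
  shows "\<exists>Q. prob_space Q \<and> sets Q = sets borel \<and>
    (\<forall>x. (\<forall>j. 0 \<le> x $ j) \<longrightarrow> measure Q {..x} = exp (- (c * (1 - measure P {..x}))))"
proof -
  let ?N = "measure_pmf (poisson_pmf c)"
  define Q where "Q = ?N \<bind> max_law P"
  have mx: "prob_space (max_law P n)" "sets (max_law P n) = sets borel" for n
    using max_law[OF P] by blast+
  have N: "?N \<in> space (prob_algebra (count_space UNIV))"
    by (simp add: space_prob_algebra measure_pmf.prob_space_axioms)
  have meas: "max_law P \<in> count_space UNIV \<rightarrow>\<^sub>M prob_algebra borel"
    by (auto simp: space_prob_algebra mx)
  interpret Q: prob_space Q unfolding Q_def by (rule prob_space_bind'[OF N meas])
  have sQ: "sets Q = sets borel" unfolding Q_def by (rule sets_bind'[OF N meas])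
  have "measure Q {..x} = exp (- (c * (1 - measure P {..x})))"
    if x: "\<forall>j. 0 \<le> x $ j" for x
  proof -
    let ?p = "measure P {..x}"
    have sm: "(\<lambda>n. exp (-c) * ((c * ?p) ^ n /\<^sub>R fact n)) sums (exp (-c) * exp (c * ?p))"
      by (intro sums_mult exp_converges)
    have "emeasure Q {..x} = (\<integral>\<^sup>+n. emeasure (max_law P n) {..x} \<partial>?N)"
      unfolding Q_def by (rule emeasure_bind_prob_algebra[OF N meas]) measurable
    also have "\<dots> = (\<integral>\<^sup>+n. ennreal (?p ^ n) \<partial>?N)"
    proof (rule nn_integral_cong)
      fix n
      interpret R: prob_space "max_law P n" by (rule mx)
      show "emeasure (max_law P n) {..x} = ennreal (?p ^ n)"
        using max_law[OF P, of n] x by (simp add: R.emeasure_eq_measure)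
    qed
    also have "\<dots> = (\<Sum>n. ennreal (exp (-c) * ((c * ?p) ^ n /\<^sub>R fact n)))"
      using c by (simp add: nn_integral_measure_pmf nn_integral_count_space_nat
          ennreal_mult'[symmetric] power_mult_distrib field_simps)
    also have "\<dots> = ennreal (exp (-c) * exp (c * ?p))"
      using sm c by (intro suminf_ennreal_eq) auto
    finally have "measure Q {..x} = exp (-c) * exp (c * ?p)"
      by (simp add: Q.emeasure_eq_measure)
    then show ?thesis by (simp add: exp_add[symmetric] algebra_simps)
  qed
  with Q.prob_space_axioms sQ show ?thesis by blast
qed

section \<open>The stable tail dependence function\<close>

text \<open>The integrand of the stable tail dependence function.\<close>

definition wmax :: "real ^ 'd::finite \<Rightarrow> real ^ 'd \<Rightarrow> real" where
  "wmax z s = (MAX j. s $ j * z $ j)"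

lemma wmax_le_iff: "wmax z s \<le> w \<longleftrightarrow> (\<forall>j. s $ j * z $ j \<le> w)"
  unfolding wmax_def by (subst Max_le_iff) auto

lemma wmax_ge: "s $ j * z $ j \<le> wmax z s"
  unfolding wmax_def by (rule Max_ge) auto

lemma stdf_wmax: "stdf H z = (\<integral>s. wmax z s \<partial>H)"
  by (simp add: stdf_def wmax_def)

text \<open>
  A spectral measure, described by a carrier with nonnegative coordinates and unit first
  moments. The carrier need not be all of the space, so that the identity is required to be
  measurable into the Borel sets.
\<close>

locale spectral_measure = finite_measure H
  for H :: "(real ^ 'd::finite) measure" +
  assumes measurable_id: "(\<lambda>s. s) \<in> borel_measurable H"
    and nonneg: "s \<in> space H \<Longrightarrow> 0 \<le> s $ j"
    and moment: "(\<integral>s. s $ j \<partial>H) = 1"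
begin

lemma measurable_coordinate [measurable]: "(\<lambda>s. s $ j) \<in> borel_measurable H"
  using measurable_vec_nth_compose[OF measurable_id] .

lemma integrable_coordinate: "integrable H (\<lambda>s. s $ j)"
  using moment[of j] not_integrable_integral_eq[of H "\<lambda>s. s $ j"] by force

lemma wmax_measurable [measurable]: "wmax z \<in> borel_measurable H"
  unfolding wmax_def by (rule borel_measurable_Max) auto

lemma wmax_nonneg:
  assumes "s \<in> space H" "\<And>j. 0 \<le> z $ j"
  shows "0 \<le> wmax z s"
  using wmax_ge[of s undefined z] nonneg[OF assms(1), of undefined] assms(2)[of undefined]
  by (meson mult_nonneg_nonneg order_trans)

lemma wmax_le_sum:
  assumes "s \<in> space H" "\<And>j. 0 \<le> z $ j"
  shows "wmax z s \<le> (\<Sum>j\<in>UNIV. s $ j * z $ j)"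
  unfolding wmax_le_iff
  using nonneg[OF assms(1)] assms(2) by (auto intro!: member_le_sum)

lemma integrable_wmax:
  assumes "\<And>j. 0 \<le> z $ j"
  shows "integrable H (wmax z)"
proof (rule Bochner_Integration.integrable_bound)
  show "integrable H (\<lambda>s. \<Sum>j\<in>UNIV. s $ j * z $ j)"
    using integrable_coordinate by auto
  show "AE s in H. norm (wmax z s) \<le> norm (\<Sum>j\<in>UNIV. s $ j * z $ j)"
  proof (intro AE_I2)
    fix s assume "s \<in> space H"
    then show "norm (wmax z s) \<le> norm (\<Sum>j\<in>UNIV. s $ j * z $ j)"
      using wmax_le_sum[OF _ assms, of s] wmax_nonneg[OF _ assms, of s]
      unfolding real_norm_def by linarith
  qed
qed measurable

lemma stdf_ge:
  assumes "\<And>j. 0 \<le> z $ j"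
  shows "z $ j \<le> stdf H z"
proof -
  have "z $ j = (\<integral>s. s $ j * z $ j \<partial>H)" using moment[of j] by simp
  also have "\<dots> \<le> stdf H z"
    unfolding stdf_wmax using integrable_coordinate integrable_wmax[OF assms]
    by (intro integral_mono) (auto intro: wmax_ge)
  finally show ?thesis .
qed

lemma stdf_le_sum:
  assumes "\<And>j. 0 \<le> z $ j"
  shows "stdf H z \<le> (\<Sum>j\<in>UNIV. z $ j)"
proof -
  have "stdf H z \<le> (\<integral>s. (\<Sum>j\<in>UNIV. s $ j * z $ j) \<partial>H)"
    unfolding stdf_wmax
  proof (rule integral_mono[OF integrable_wmax[OF assms]])
    show "integrable H (\<lambda>s. \<Sum>j\<in>UNIV. s $ j * z $ j)"
      using integrable_coordinate by auto
  qed (rule wmax_le_sum[OF _ assms])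
  also have "\<dots> = (\<Sum>j\<in>UNIV. z $ j)"
    using integrable_coordinate moment by simp
  finally show ?thesis .
qed

lemma stdf_nonneg:
  assumes "\<And>j. 0 \<le> z $ j"
  shows "0 \<le> stdf H z"
  using stdf_ge[of z undefined] assms[of undefined] assms by (meson order_trans)

lemma mass_pos: "0 < measure H (space H)"
proof -
  have "measure H (space H) \<noteq> 0"
  proof
    assume "measure H (space H) = 0"
    then have "AE s in H. s $ undefined = 0"
      by (simp add: emeasure_eq_measure AE_iff_measurable null_sets_def emeasure_0_AE)
    then have "(\<integral>s. s $ undefined \<partial>H) = 0"
      by (simp add: integral_eq_zero_AE)
    with moment show False by simp
  qed
  then show ?thesis using measure_nonneg[of H "space H"] by linarith
qed

text \<open>
  The law of \<open>s / w\<close> when \<open>s\<close> follows the normalised spectral measure and \<open>w\<close> is uniform on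
  \<open>(k, k + 1]\<close>. Multiplied by the mass of \<open>H\<close>, it is the image under \<open>(s, w) \<mapsto> s / w\<close>
  of the product of \<open>H\<close> and Lebesgue measure on this layer.
\<close>

definition layer_law :: "nat \<Rightarrow> (real ^ 'd) measure" where
  "layer_law k =
     distr (density H (\<lambda>_. ennreal (1 / measure H (space H))) \<Otimes>\<^sub>M
              uniform_measure lborel {real k<..real k + 1}) borel
       (\<lambda>p. \<chi> j. fst p $ j / snd p)"

text \<open>
  For \<open>w > 0\<close>, the point \<open>s / w\<close> is at most \<open>x\<close> iff \<open>max\<^sub>j (s\<^sub>j / x\<^sub>j) \<le> w\<close>. The layer thus
  gives to the complement of \<open>{..x}\<close> the integral of the length of the part of \<open>(k, k + 1]\<close>
  below that maximum, an increment of its truncations.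
\<close>

lemma layer_law_props:
  shows "prob_space (layer_law k)" "sets (layer_law k) = sets borel"
    and "(\<And>j. 0 < x $ j) \<Longrightarrow>
      measure H (space H) * (1 - measure (layer_law k) {..x})
        = (\<integral>s. min (wmax (\<chi> j. 1 / x $ j) s) (real (Suc k)) \<partial>H)
          - (\<integral>s. min (wmax (\<chi> j. 1 / x $ j) s) (real k) \<partial>H)"
proof -
  let ?c = "measure H (space H)"
  let ?H = "density H (\<lambda>_. ennreal (1 / ?c))"
  let ?U = "uniform_measure lborel {real k<..real k + 1}"
  let ?f = "\<lambda>p :: (real ^ 'd) \<times> real. (\<chi> j. fst p $ j / snd p) :: real ^ 'd"
  have c: "0 < ?c" by (rule mass_pos)
  interpret U: prob_space ?U by (rule prob_space_uniform_measure) auto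
  have "emeasure ?H (space ?H) = 1"
    using c by (simp add: emeasure_density emeasure_eq_measure ennreal_mult'[symmetric])
  then interpret H': prob_space ?H by (rule prob_spaceI)
  interpret HU: pair_prob_space ?H ?U ..
  have [measurable]: "?f \<in> borel_measurable (?H \<Otimes>\<^sub>M ?U)"
    by measurable
  show "prob_space (layer_law k)" unfolding layer_law_def
    by (rule HU.P.prob_space_distr) measurable
  then interpret L: prob_space "layer_law k" .
  show "sets (layer_law k) = sets borel" by (simp add: layer_law_def)
  assume x: "\<And>j. 0 < x $ j"
  define z where "z = (\<chi> j. 1 / x $ j)"
  have z: "0 \<le> z $ j" for j using x[of j] by (simp add: z_def)
  let ?g = "\<lambda>k s. min (wmax z s) (real k)"
  have intg: "integrable H (?g k)" for k
    by (rule Bochner_Integration.integrable_bound[OF integrable_wmax[OF z]])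
      (auto intro!: AE_I2 simp: wmax_nonneg[OF _ z])
  have inner: "emeasure ?U (Pair s -` (?f -` {..x} \<inter> space (?H \<Otimes>\<^sub>M ?U)))
      = ennreal (1 - (?g (Suc k) s - ?g k s))" if s: "s \<in> space H" for s
  proof -
    let ?I = "{real k<..real k + 1}"
    have A: "Pair s -` (?f -` {..x} \<inter> space (?H \<Otimes>\<^sub>M ?U)) = {w. \<forall>j. s $ j / w \<le> x $ j}"
      using s by (auto simp: less_eq_vec_def space_pair_measure)
    have B: "{w. \<forall>j. s $ j / w \<le> x $ j} \<in> sets lborel" by measurable
    have "s $ j / w \<le> x $ j \<longleftrightarrow> s $ j * z $ j \<le> w" if "w \<in> ?I" for w j
    proof -
      have "0 < w" using that by (auto intro: le_less_trans[of 0 "real k"])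
      then show ?thesis using x[of j] by (simp add: z_def field_simps)
    qed
    then have C: "?I \<inter> {w. \<forall>j. s $ j / w \<le> x $ j} = ?I \<inter> {wmax z s..}"
      by (auto simp: wmax_le_iff)
    have "emeasure ?U {w. \<forall>j. s $ j / w \<le> x $ j} = emeasure lborel (?I \<inter> {wmax z s..})"
      using emeasure_uniform_measure[OF _ B, of ?I] by (simp add: C divide_ennreal_def)
    also have "?I \<inter> {wmax z s..} = (if wmax z s \<le> real k then ?I else {wmax z s..real k + 1})"
      by (auto)
    also have "emeasure lborel \<dots> = ennreal (1 - (?g (Suc k) s - ?g k s))"
      by (cases "wmax z s \<le> real k"; cases "wmax z s \<le> real k + 1")
        (auto simp: min_def emeasure_lborel_Icc_eq algebra_simps
 intro!: arg_cong[where f = ennreal])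
    finally show ?thesis unfolding A .
  qed
  have "emeasure (layer_law k) {..x}
      = emeasure (?H \<Otimes>\<^sub>M ?U) (?f -` {..x} \<inter> space (?H \<Otimes>\<^sub>M ?U))"
    unfolding layer_law_def by (rule emeasure_distr) measurable
  also have "\<dots> = (\<integral>\<^sup>+s. emeasure ?U (Pair s -` (?f -` {..x} \<inter> space (?H \<Otimes>\<^sub>M ?U))) \<partial>?H)"
    by (rule U.emeasure_pair_measure_alt) measurable
  also have "\<dots> = (\<integral>\<^sup>+s. ennreal (1 - (?g (Suc k) s - ?g k s)) \<partial>?H)"
    by (rule nn_integral_cong, rule inner) simp
  also have "\<dots> = (\<integral>\<^sup>+s. ennreal ((1 - (?g (Suc k) s - ?g k s)) / ?c) \<partial>H)"
    using c by (subst nn_integral_density)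
      (auto simp: ennreal_mult'[symmetric] intro!: nn_integral_cong)
  also have "\<dots> = ennreal (\<integral>s. (1 - (?g (Suc k) s - ?g k s)) / ?c \<partial>H)"
    using intg[of k] intg[of "Suc k"] c by (intro nn_integral_eq_integral) (auto intro!: AE_I2 divide_nonneg_pos)
  also have "(\<integral>s. (1 - (?g (Suc k) s - ?g k s)) / ?c \<partial>H)
      = (?c - ((\<integral>s. ?g (Suc k) s \<partial>H) - (\<integral>s. ?g k s \<partial>H))) / ?c"
    using intg[of k] intg[of "Suc k"] by simp
  finally have "emeasure (layer_law k) {..x} =
      ennreal ((?c - ((\<integral>s. ?g (Suc k) s \<partial>H) - (\<integral>s. ?g k s \<partial>H))) / ?c)" .
  moreover have "(\<integral>s. ?g (Suc k) s \<partial>H) - (\<integral>s. ?g k s \<partial>H) \<le> ?c"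
  proof -
    have "(\<integral>s. ?g (Suc k) s \<partial>H) - (\<integral>s. ?g k s \<partial>H) = (\<integral>s. ?g (Suc k) s - ?g k s \<partial>H)"
      using intg[of k] intg[of "Suc k"] by simp
    also have "\<dots> \<le> (\<integral>s. 1 \<partial>H)"
      using intg[of k] intg[of "Suc k"] by (intro integral_mono) (auto simp: min_def)
    finally show ?thesis by simp
  qed
  ultimately have "measure (layer_law k) {..x} =
      (?c - ((\<integral>s. ?g (Suc k) s \<partial>H) - (\<integral>s. ?g k s \<partial>H))) / ?c"
    using c by (simp add: L.emeasure_eq_measure)
  then show "?c * (1 - measure (layer_law k) {..x})
        = (\<integral>s. min (wmax (\<chi> j. 1 / x $ j) s) (real (Suc k)) \<partial>H)
          - (\<integral>s. min (wmax (\<chi> j. 1 / x $ j) s) (real k) \<partial>H)"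
    using c unfolding z_def[symmetric] by (simp add: field_simps)
qed

end

section \<open>Construction of the simple max-stable law\<close>

text \<open>
  The product of a sequence of possibly different probability measures evaluates a countable
  box as the limit of the finite products.
\<close>

lemma measure_PiM_countable_box:
  fixes M :: "nat \<Rightarrow> 'a measure"
  assumes M: "\<And>k. prob_space (M k)" and E: "\<And>k. E k \<in> sets (M k)"
  shows "(\<lambda>n. \<Prod>k<n. measure (M k) (E k)) \<longlonglongrightarrow> measure (Pi\<^sub>M UNIV M) (Pi UNIV E)"
proof -
  interpret Mk: prob_space "M k" for k by (rule M)
  interpret product_prob_space M UNIV ..
  let ?E = "\<lambda>n. prod_emb UNIV M {..<n} (Pi\<^sub>E {..<n} E)"
  have "\<And>n. (\<Prod>k<n. measure (M k) (E k)) = measure (Pi\<^sub>M UNIV M) (?E n)"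
    using E by (simp add: measure_PiM_emb)
  moreover have "Pi UNIV E = (\<Inter>n. ?E n)"
  proof (intro equalityI subsetI)
    fix x assume x: "x \<in> (\<Inter>n. ?E n)"
    have "x k \<in> E k" for k
    proof -
      have "x \<in> ?E (Suc k)" using x by blast
      then show ?thesis by (auto simp: prod_emb_def)
    qed
    then show "x \<in> Pi UNIV E" by simp
  qed (use E[THEN sets.sets_into_space] in \<open>auto simp: prod_emb_def extensional_def Pi_iff\<close>)
  moreover have "range ?E \<subseteq> sets (Pi\<^sub>M UNIV M)"
    using E by auto
  moreover have "decseq ?E"
    by (auto simp: prod_emb_def Pi_iff decseq_def)
  ultimately show ?thesis
    by (simp add: finite_Lim_measure_decseq)
qed

context spectral_measure
begin

lemma max_stable_df_pos:
  "(\<And>j. 0 < x $ j) \<Longrightarrow> max_stable_df H \<alpha> x = exp (- stdf H (\<chi> j. x $ j powr (- \<alpha>)))"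
  by (simp add: max_stable_df_def)

lemma max_stable_df_margin_le:
  "max_stable_df H \<alpha> x \<le> (if 0 < x $ j then exp (- (x $ j powr (- \<alpha>))) else 0)"
  using stdf_ge[of "\<chi> j. x $ j powr (- \<alpha>)" j] by (auto simp: max_stable_df_def)

text \<open>
  Margins are recovered by sending the other coordinates to infinity; this only uses
  \<open>z\<^sub>j \<le> \<ell>(z) \<le> (\<Sum>i. z\<^sub>i)\<close>.
\<close>

lemma max_stable_df_margin_limit:
  assumes t: "0 < t" and a: "0 < \<alpha>"
  shows "(\<lambda>n. max_stable_df H \<alpha> (\<chi> i. if i = j then t else real (Suc n)))
    \<longlonglongrightarrow> exp (- (t powr (- \<alpha>)))"
proof -
  define z where "z n = (\<chi> i. (if i = j then t else real (Suc n)) powr (- \<alpha>)) " for n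
  have z: "0 \<le> z n $ i" for n i by (simp add: z_def)
  have zj: "z n $ j = t powr (- \<alpha>)" for n by (simp add: z_def)
  have decay: "(\<lambda>n. real (Suc n) powr (- \<alpha>)) \<longlonglongrightarrow> 0"
    using a by (intro tendsto_neg_powr filterlim_compose[OF filterlim_real_sequentially filterlim_Suc]) auto
  have "(\<lambda>n. \<Sum>i\<in>UNIV. z n $ i) \<longlonglongrightarrow> (\<Sum>i\<in>UNIV. if i = j then t powr (- \<alpha>) else 0)"
    using decay by (intro tendsto_sum) (auto simp: z_def)
  then have sums: "(\<lambda>n. \<Sum>i\<in>UNIV. z n $ i) \<longlonglongrightarrow> t powr (- \<alpha>)" by simp
  have "(\<lambda>n. stdf H (z n)) \<longlonglongrightarrow> t powr (- \<alpha>)"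
  proof (rule tendsto_sandwich[OF _ _ tendsto_const sums])
    show "eventually (\<lambda>n. t powr (- \<alpha>) \<le> stdf H (z n)) sequentially"
      using stdf_ge[OF z, of _ j] by (simp add: zj)
    show "eventually (\<lambda>n. stdf H (z n) \<le> (\<Sum>i\<in>UNIV. z n $ i)) sequentially"
      using stdf_le_sum[OF z] by simp
  qed
  moreover have "max_stable_df H \<alpha> (\<chi> i. if i = j then t else real (Suc n)) = exp (- stdf H (z n))" for n
    using t by (subst max_stable_df_pos) (simp_all add: z_def)
  ultimately show ?thesis
    by (auto intro!: tendsto_intros)
qed

lemma prod_exp_layers:
  assumes z: "\<And>j. 0 \<le> z $ j"
  shows "(\<lambda>n. \<Prod>k<n. exp (- ((\<integral>s. min (wmax z s) (real (Suc k)) \<partial>H)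
      - (\<integral>s. min (wmax z s) (real k) \<partial>H)))) \<longlonglongrightarrow> exp (- stdf H z)"
proof -
  let ?G = "\<lambda>k. \<integral>s. min (wmax z s) (real k) \<partial>H"
  have "(\<Prod>k<n. exp (- (?G (Suc k) - ?G k))) = exp (- (?G n - ?G 0))" for n
    using sum_lessThan_telescope[of ?G n] by (simp only: exp_sum[symmetric] sum_negf finite_lessThan)
  moreover have "?G 0 = 0"
  proof -
    have "?G 0 = (\<integral>s. 0 \<partial>H)"
      using wmax_nonneg[OF _ z] by (intro Bochner_Integration.integral_cong) (auto simp: min_def intro: antisym)
    then show ?thesis by simp
  qed
  moreover have "?G \<longlonglongrightarrow> stdf H z"
    unfolding stdf_wmax
  proof (rule integral_dominated_convergence[OF _ _ integrable_wmax[OF z]])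
    show "AE s in H. (\<lambda>k. min (wmax z s) (real k)) \<longlonglongrightarrow> wmax z s"
    proof (rule AE_I2)
      fix s
      obtain n where n: "wmax z s \<le> real n" using real_arch_simple by blast
      have "eventually (\<lambda>k. min (wmax z s) (real k) = wmax z s) sequentially"
        using n by (intro eventually_sequentiallyI[of n]) linarith
      then show "(\<lambda>k. min (wmax z s) (real k)) \<longlonglongrightarrow> wmax z s"
        by (rule tendsto_eventually)
    qed
    show "AE s in H. norm (min (wmax z s) (real k)) \<le> wmax z s" for k
      using wmax_nonneg[OF _ z] by (intro AE_I2) auto
  qed measurable
  ultimately show ?thesis by (auto intro!: tendsto_intros)
qed

text \<open>
  The componentwise supremum of independent Poisson maxima, one for each layer, has
  distribution function \<open>F\<^sub>1\<close>.
\<close>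

lemma exists_simple_max_stable_law: "\<exists>\<mu>. is_law_of \<mu> (max_stable_df H 1)"
proof -
  have "\<exists>Q. prob_space Q \<and> sets Q = sets borel \<and> (\<forall>x. (\<forall>j. 0 \<le> x $ j) \<longrightarrow>
      measure Q {..x} = exp (- (measure H (space H) * (1 - measure (layer_law k) {..x}))))" for k
    by (rule exists_poisson_max_law[OF layer_law_props(1,2) mass_pos])
  then obtain Q :: "nat \<Rightarrow> (real ^ 'd) measure" where Q: "prob_space (Q k)" "sets (Q k) = sets borel"
    "(\<forall>j. 0 \<le> x $ j) \<Longrightarrow>
      measure (Q k) {..x} = exp (- (measure H (space H) * (1 - measure (layer_law k) {..x})))" for k x
    by metis
  interpret Qk: prob_space "Q k" for k by (rule Q)
  let ?\<Omega> = "Pi\<^sub>M UNIV Q"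
  have spQ: "space (Q k) = UNIV" for k using Q(2) sets_eq_imp_space_eq space_borel by metis
  have sp: "space ?\<Omega> = UNIV" by (simp add: space_PiM spQ)
  have comp [measurable]: "(\<lambda>\<omega>. \<omega> k) \<in> borel_measurable ?\<Omega>" for k
  proof -
    have "(\<lambda>\<omega>. \<omega> k) \<in> ?\<Omega> \<rightarrow>\<^sub>M Q k" by (rule measurable_component_singleton) simp
    then show ?thesis by (simp add: measurable_cong_sets[OF refl Q(2)])
  qed
  have box: "measure ?\<Omega> {\<omega>. \<forall>k. \<omega> k \<le> x} = exp (- stdf H (\<chi> j. 1 / x $ j))"
    if x: "\<And>j. 0 < x $ j" for x
  proof -
    let ?z = "\<chi> j. 1 / x $ j"
    have eq: "measure (Q k) {..x} = exp (- ((\<integral>s. min (wmax ?z s) (real (Suc k)) \<partial>H)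
          - (\<integral>s. min (wmax ?z s) (real k) \<partial>H)))" for k
      using Q(3)[of x k] layer_law_props(3)[OF x, of k] x less_imp_le by metis
    have "(\<lambda>n. \<Prod>k<n. measure (Q k) {..x}) \<longlonglongrightarrow> measure ?\<Omega> (Pi UNIV (\<lambda>_. {..x}))"
      by (rule measure_PiM_countable_box) (auto simp: Q)
    moreover have "(\<lambda>n. \<Prod>k<n. measure (Q k) {..x}) \<longlonglongrightarrow> exp (- stdf H ?z)"
      unfolding eq by (rule prod_exp_layers) (simp add: x less_imp_le)
    moreover have "Pi UNIV (\<lambda>_. {..x}) = {\<omega> :: nat \<Rightarrow> real ^ 'd. \<forall>k. \<omega> k \<le> x}" by auto
    ultimately show ?thesis using LIMSEQ_unique by metis
  qed
  interpret Om: prob_space ?\<Omega> by (rule prob_space_PiM) (rule Q)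
  have le_meas [measurable]: "{\<omega>. \<forall>k. \<omega> k \<le> x} \<in> sets ?\<Omega>" for x
  proof -
    have "{\<omega> \<in> space ?\<Omega>. \<forall>k j. \<omega> k $ j \<le> x $ j} \<in> sets ?\<Omega>" by measurable
    then show ?thesis by (simp add: sp less_eq_vec_def)
  qed
  \<comment> \<open>The supremum over the layers is almost surely finite, because the probability that all
    layers stay below \<open>n + 1\<close> tends to \<open>1\<close>.\<close>
  define A where "A n = {\<omega> :: nat \<Rightarrow> real ^ 'd. \<forall>k. \<omega> k \<le> (\<chi> j. real (Suc n))}" for n
  have A [measurable]: "A n \<in> sets ?\<Omega>" for n unfolding A_def by (rule le_meas)
  have bounded: "AE \<omega> in ?\<Omega>. \<exists>n. \<omega> \<in> A n"
  proof -
    have "exp (- (real CARD('d) / real (Suc n))) \<le> measure ?\<Omega> (\<Union>n. A n)" for n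
    proof -
      have "stdf H (\<chi> j. 1 / real (Suc n)) \<le> real CARD('d) / real (Suc n)"
        using stdf_le_sum[of "\<chi> j. 1 / real (Suc n)"] by simp
      then have "exp (- (real CARD('d) / real (Suc n))) \<le> measure ?\<Omega> (A n)"
        unfolding A_def by (subst box) auto
      also have "\<dots> \<le> measure ?\<Omega> (\<Union>n. A n)"
        by (intro Om.finite_measure_mono) auto
      finally show ?thesis .
    qed
    moreover have "(\<lambda>n. exp (- (real CARD('d) / real (Suc n)))) \<longlonglongrightarrow> exp (- 0)"
      by (intro tendsto_intros real_tendsto_divide_at_top[OF tendsto_const]
          filterlim_compose[OF filterlim_real_sequentially filterlim_Suc])
    ultimately have "exp (- 0) \<le> measure ?\<Omega> (\<Union>n. A n)"
      by (intro LIMSEQ_le_const2) auto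
    then have "measure ?\<Omega> (\<Union>n. A n) = 1"
      using Om.prob_le_1 by (intro antisym) auto
    then show ?thesis
      by (subst (asm) Om.prob_eq_1) auto
  qed
  define Z :: "(nat \<Rightarrow> real ^ 'd) \<Rightarrow> real ^ 'd"
    where "Z \<omega> = (\<chi> j. real_of_ereal (SUP k. ereal (\<omega> k $ j)))" for \<omega>
  have Zm [measurable]: "Z \<in> borel_measurable ?\<Omega>" unfolding Z_def by measurable
  have Z_le_iff: "Z \<omega> \<le> x \<longleftrightarrow> (\<forall>k. \<omega> k \<le> x)" if "\<omega> \<in> A n" for \<omega> n x
  proof -
    have "real_of_ereal (SUP k. ereal (\<omega> k $ j)) \<le> x $ j \<longleftrightarrow> (\<forall>k. \<omega> k $ j \<le> x $ j)" for j
    proof -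
      have "(SUP k. ereal (\<omega> k $ j)) \<le> ereal (real (Suc n))"
        using that by (intro SUP_least) (auto simp: A_def less_eq_vec_def)
      moreover have "ereal (\<omega> 0 $ j) \<le> (SUP k. ereal (\<omega> k $ j))" by (rule SUP_upper) simp
      ultimately obtain r where r: "(SUP k. ereal (\<omega> k $ j)) = ereal r"
        by (cases "SUP k. ereal (\<omega> k $ j)") auto
      then have "r \<le> x $ j \<longleftrightarrow> (SUP k. ereal (\<omega> k $ j)) \<le> ereal (x $ j)" by simp
      also have "\<dots> \<longleftrightarrow> (\<forall>k. \<omega> k $ j \<le> x $ j)" unfolding SUP_le_iff by simp
      finally show ?thesis using r by simp
    qed
    then show ?thesis by (auto simp: Z_def less_eq_vec_def)
  qed
  let ?\<mu> = "distr ?\<Omega> borel Z"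
  interpret mu: prob_space ?\<mu> by (rule Om.prob_space_distr) measurable
  have pos: "measure ?\<mu> {..x} = max_stable_df H 1 x" if x: "\<And>j. 0 < x $ j" for x
  proof -
    have "measure ?\<mu> {..x} = measure ?\<Omega> {\<omega>. Z \<omega> \<le> x}"
      by (subst measure_distr) (auto simp: sp vimage_def)
    also have "\<dots> = measure ?\<Omega> {\<omega>. \<forall>k. \<omega> k \<le> x}"
    proof (rule Om.finite_measure_eq_AE)
      show "AE \<omega> in ?\<Omega>. \<omega> \<in> {\<omega>. Z \<omega> \<le> x} \<longleftrightarrow> \<omega> \<in> {\<omega>. \<forall>k. \<omega> k \<le> x}"
        using bounded by eventually_elim (auto simp: Z_le_iff)
      have "Z -` {..x} \<inter> space ?\<Omega> \<in> sets ?\<Omega>" by measurable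
      then show "{\<omega>. Z \<omega> \<le> x} \<in> sets ?\<Omega>" by (simp add: sp vimage_def)
    qed (rule le_meas)
    also have "\<dots> = max_stable_df H 1 x"
      using x by (subst box) (auto simp: max_stable_df_pos powr_minus_divide less_imp_le)
    finally show ?thesis .
  qed
  have "measure ?\<mu> {..x} = max_stable_df H 1 x" for x
  proof (cases "\<forall>j. 0 < x $ j")
    case False
    then obtain j where j: "x $ j \<le> 0" by (auto simp: not_less)
    \<comment> \<open>The coordinate \<open>j\<close> is almost surely positive, as its margin is at most
      \<open>exp (- 1 / e)\<close> at every positive \<open>e\<close>.\<close>
    have "measure ?\<mu> {..x} \<le> exp (- real (Suc n))" for n
    proof -
      define y where "y = (\<chi> i. if i = j then 1 / real (Suc n) else max 1 (x $ i))"
      have "measure ?\<mu> {..x} \<le> measure ?\<mu> {..y}"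
        using j by (intro mu.finite_measure_mono)
          (auto simp: y_def less_eq_vec_def max_def intro: order_trans)
      also have "\<dots> = max_stable_df H 1 y" by (rule pos) (auto simp: y_def max_def)
      also have "\<dots> \<le> exp (- real (Suc n))"
        using max_stable_df_margin_le[of 1 y j] by (simp add: y_def powr_minus_divide)
      finally show ?thesis .
    qed
    moreover have "(\<lambda>n. exp (- real (Suc n))) \<longlonglongrightarrow> 0"
      by (intro filterlim_compose[OF exp_at_bot] filterlim_compose[OF filterlim_uminus_at_bot_at_top]
          filterlim_compose[OF filterlim_real_sequentially filterlim_Suc])
    ultimately have "measure ?\<mu> {..x} \<le> 0"
      by (intro LIMSEQ_le_const) auto
    then have "measure ?\<mu> {..x} = 0" using measure_nonneg[of ?\<mu> "{..x}"] by linarith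
    then show ?thesis using False by (simp add: max_stable_df_def)
  qed (use pos in blast)
  then have "is_law_of ?\<mu> (max_stable_df H 1)"
    using mu.prob_space_axioms by (simp add: is_law_of_def)
  then show ?thesis by blast
qed

end

section \<open>Frechet margins and the laws with arbitrary shape\<close>

text \<open>The standard exponential law; a unit-\<open>\<alpha>\<close>-Frechet variable is \<open>t powr (- 1 / \<alpha>)\<close> under it.\<close>

abbreviation exp_law :: "real measure" where
  "exp_law \<equiv> density lborel (\<lambda>t. ennreal (exponential_density 1 t))"

lemma nn_integral_exp_law:
  assumes [measurable]: "f \<in> borel_measurable borel"
  shows "(\<integral>\<^sup>+t. f t \<partial>exp_law) = (\<integral>\<^sup>+t\<in>{0<..}. f t * ennreal (exp (- t)) \<partial>lborel)"
proof -
  have "(\<integral>\<^sup>+t. f t \<partial>exp_law) = (\<integral>\<^sup>+t. ennreal (exponential_density 1 t) * f t \<partial>lborel)"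
    by (rule nn_integral_density) measurable
  also have "\<dots> = (\<integral>\<^sup>+t\<in>{0<..}. f t * ennreal (exp (- t)) \<partial>lborel)"
    using AE_lborel_singleton[of 0]
    by (intro nn_integral_cong_AE)
      (auto simp: exponential_density_def indicator_def mult.commute elim!: eventually_mono)
  finally show ?thesis .
qed

lemma exp_law_AE_pos: "AE t in exp_law. 0 < t"
  using AE_lborel_singleton[of 0]
  by (subst AE_density) (auto simp: exponential_density_def elim!: eventually_mono)

lemma exp_law_atLeast:
  assumes "0 \<le> u"
  shows "measure exp_law {u..} = exp (- u)"
proof -
  have "emeasure exp_law {u..} = (\<integral>\<^sup>+t. ennreal (exp (- t)) * indicator {u..} t \<partial>lborel)"
    using assms by (subst emeasure_density)
      (auto simp: exponential_density_def indicator_def intro!: nn_integral_cong)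
  also have "\<dots> = ennreal (0 - (- exp (- u)))"
  proof (rule nn_integral_FTC_atLeast[where F = "\<lambda>t. - exp (- t)"])
    show "((\<lambda>t :: real. - exp (- t)) \<longlongrightarrow> 0) at_top"
      using tendsto_minus[OF filterlim_compose[OF exp_at_bot filterlim_uminus_at_bot_at_top]] by simp
  qed (auto intro!: derivative_eq_intros)
  finally show ?thesis by (simp add: measure_def)
qed

context spectral_measure
begin

text \<open>The law of \<open>Z\<close>, with unit-1-Frechet margins.\<close>

definition simple_law :: "(real ^ 'd) measure" where
  "simple_law = law_of (max_stable_df H 1)"

lemma is_law_of_simple_law: "is_law_of simple_law (max_stable_df H 1)"
  using exists_simple_max_stable_law law_of_eqI unfolding simple_law_def by metis

sublocale Z: prob_space simple_law
  using is_law_of_simple_law by (simp add: is_law_of_def)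

lemma sets_simple_law [simp, measurable_cong]: "sets simple_law = sets borel"
  using is_law_of_simple_law by (simp add: is_law_of_def)

lemma space_simple_law [simp]: "space simple_law = UNIV"
  using sets_eq_imp_space_eq[OF sets_simple_law] by simp

lemma simple_law_atMost: "Z.prob {..x} = max_stable_df H 1 x"
  using is_law_of_simple_law by (simp add: is_law_of_def)

lemma simple_law_margin_pos:
  assumes "0 < t"
  shows "Z.prob {z. z $ j \<le> t} = exp (- (1 / t))"
proof -
  define y where "y n = (\<chi> i. if i = j then t else real (Suc n))" for n
  have "(\<lambda>n. Z.prob {..y n}) \<longlonglongrightarrow> Z.prob (\<Union>n. {..y n})"
    by (rule Z.finite_Lim_measure_incseq) (auto simp: incseq_def y_def less_eq_vec_def intro: order_trans)
  moreover have "(\<Union>n. {..y n}) = {z. z $ j \<le> t}"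
  proof (intro equalityI subsetI)
    fix z assume z: "z \<in> {z. z $ j \<le> t}"
    obtain n where "norm z \<le> real n" using real_arch_simple by blast
    then have "z $ i \<le> real (Suc n)" for i
      using component_le_norm_cart[of z i] by simp
    with z show "z \<in> (\<Union>n. {..y n})" by (auto simp: y_def less_eq_vec_def intro!: exI[of _ n])
  qed (auto simp: y_def less_eq_vec_def split: if_splits)
  moreover have "(\<lambda>n. Z.prob {..y n}) \<longlonglongrightarrow> exp (- (t powr (- 1)))"
    unfolding simple_law_atMost y_def by (rule max_stable_df_margin_limit) (use assms in auto)
  ultimately show ?thesis
    using assms LIMSEQ_unique by (fastforce simp: powr_minus_divide)
qed

lemma simple_law_margin_nonpos:
  assumes "t \<le> 0"
  shows "Z.prob {z. z $ j \<le> t} = 0"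
proof -
  have "Z.prob {z. z $ j \<le> t} \<le> exp (- real (Suc n))" for n
  proof -
    have "t \<le> 1 / real (Suc n)" using assms by (rule order_trans) simp
    then have "Z.prob {z. z $ j \<le> t} \<le> Z.prob {z. z $ j \<le> 1 / real (Suc n)}"
      by (intro Z.finite_measure_mono) auto
    also have "\<dots> = exp (- real (Suc n))" by (simp add: simple_law_margin_pos)
    finally show ?thesis .
  qed
  moreover have "(\<lambda>n. exp (- real (Suc n))) \<longlonglongrightarrow> 0"
    by (intro filterlim_compose[OF exp_at_bot] filterlim_compose[OF filterlim_uminus_at_bot_at_top]
        filterlim_compose[OF filterlim_real_sequentially filterlim_Suc])
  ultimately have "Z.prob {z. z $ j \<le> t} \<le> 0"
    by (intro LIMSEQ_le_const) auto
  then show ?thesis using measure_nonneg[of simple_law] by (metis antisym)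
qed

lemma simple_law_AE_pos: "AE z in simple_law. \<forall>j. 0 < z $ j"
proof -
  have "AE z in simple_law. 0 < z $ j" for j
  proof (rule AE_I[where N = "{z. z $ j \<le> 0}"])
    show "emeasure simple_law {z. z $ j \<le> 0} = 0"
      using simple_law_margin_nonpos[of 0 j] by (simp add: Z.emeasure_eq_measure)
  qed auto
  then show ?thesis by (simp add: AE_all_countable)
qed

lemma simple_law_margin: "distr simple_law borel (\<lambda>z. z $ j) = distr exp_law borel (\<lambda>t. 1 / t)"
proof (rule cdf_unique)
  interpret E: prob_space exp_law by (rule prob_space_exponential_density) simp
  show "real_distribution (distr simple_law borel (\<lambda>z. z $ j))"
    by (intro Z.real_distribution_distr) auto
  show "real_distribution (distr exp_law borel (\<lambda>t. 1 / t))"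
    by (intro E.real_distribution_distr) auto
  show "cdf (distr simple_law borel (\<lambda>z. z $ j)) = cdf (distr exp_law borel (\<lambda>t. 1 / t))"
  proof
    fix t
    have L: "cdf (distr simple_law borel (\<lambda>z. z $ j)) t = Z.prob {z. z $ j \<le> t}"
      by (simp add: cdf_def measure_distr vimage_def)
    have R: "cdf (distr exp_law borel (\<lambda>t. 1 / t)) t = E.prob {x. 1 / x \<le> t}"
      by (simp add: cdf_def measure_distr vimage_def)
    have "E.prob {x. 1 / x \<le> t} = E.prob (if 0 < t then {1 / t..} else {})"
    proof (rule E.finite_measure_eq_AE)
      show "AE x in exp_law. x \<in> {x. 1 / x \<le> t} \<longleftrightarrow> x \<in> (if 0 < t then {1 / t..} else {})"
        using exp_law_AE_pos
      proof eventually_elim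
        case (elim x)
        show ?case
        proof (cases "0 < t")
          case True then show ?thesis using elim by (simp add: field_simps)
        next
          case False
          have "0 < 1 / x" using elim by simp
          with False show ?thesis by (auto simp del: zero_less_divide_1_iff)
        qed
      qed
    qed measurable
    then show "cdf (distr simple_law borel (\<lambda>z. z $ j)) t = cdf (distr exp_law borel (\<lambda>t. 1 / t)) t"
      unfolding L R using exp_law_atLeast[of "1 / t"]
      by (cases "0 < t") (auto simp: simple_law_margin_pos simple_law_margin_nonpos)
  qed
qed

lemma nn_integral_simple_law_margin:
  assumes [measurable]: "f \<in> borel_measurable borel"
  shows "(\<integral>\<^sup>+z. f (z $ j) \<partial>simple_law) = (\<integral>\<^sup>+t. f (1 / t) \<partial>exp_law)"
proof -
  have "(\<integral>\<^sup>+z. f (z $ j) \<partial>simple_law) = (\<integral>\<^sup>+t. f t \<partial>distr simple_law borel (\<lambda>z. z $ j))"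
    by (subst nn_integral_distr) auto
  also have "\<dots> = (\<integral>\<^sup>+t. f (1 / t) \<partial>exp_law)"
    unfolding simple_law_margin by (subst nn_integral_distr) auto
  finally show ?thesis .
qed

text \<open>The law with shape \<open>\<alpha>\<close> is the image of the simple one under the power \<open>1 / \<alpha>\<close>.\<close>

definition power_map :: "real \<Rightarrow> real ^ 'd \<Rightarrow> real ^ 'd" where
  "power_map \<alpha> z = (\<chi> j. z $ j powr (1 / \<alpha>))"

lemma power_map_measurable [measurable]: "power_map \<alpha> \<in> borel_measurable borel"
  unfolding power_map_def by measurable

lemma max_stable_df_eq_simple:
  assumes "\<And>j. 0 < x $ j"
  shows "max_stable_df H \<alpha> x = Z.prob {..(\<chi> j. x $ j powr \<alpha>)}"
proof -
  have nz: "x $ j \<noteq> 0" for j using assms[of j] by simp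
  have "max_stable_df H 1 (\<chi> j. x $ j powr \<alpha>) = exp (- stdf H (\<chi> j. x $ j powr (- \<alpha>)))"
    by (subst max_stable_df_pos) (simp_all add: nz powr_powr powr_minus_divide)
  then show ?thesis
    unfolding simple_law_atMost using assms by (simp add: max_stable_df_pos)
qed

lemma law_of_max_stable_df:
  assumes a: "0 < \<alpha>"
  shows "law_of (max_stable_df H \<alpha>) = distr simple_law borel (power_map \<alpha>)"
proof (rule law_of_eqI)
  have "measure (distr simple_law borel (power_map \<alpha>)) {..x} = max_stable_df H \<alpha> x" for x
  proof -
    have "measure (distr simple_law borel (power_map \<alpha>)) {..x} = Z.prob {z. power_map \<alpha> z \<le> x}"
      by (simp add: measure_distr vimage_def)
    also have "\<dots> = Z.prob (if \<forall>j. 0 < x $ j then {..(\<chi> j. x $ j powr \<alpha>)} else {})"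
    proof (rule Z.finite_measure_eq_AE)
      show "AE z in simple_law. z \<in> {z. power_map \<alpha> z \<le> x} \<longleftrightarrow>
          z \<in> (if \<forall>j. 0 < x $ j then {..(\<chi> j. x $ j powr \<alpha>)} else {})"
        using simple_law_AE_pos
      proof eventually_elim
        case (elim z)
        have le: "z $ j powr (1 / \<alpha>) \<le> x $ j \<longleftrightarrow> 0 < x $ j \<and> z $ j \<le> x $ j powr \<alpha>" for j
        proof (cases "0 < x $ j")
          case True
          have "z $ j powr (1 / \<alpha>) \<le> x $ j \<longleftrightarrow> (z $ j powr (1 / \<alpha>)) powr \<alpha> \<le> x $ j powr \<alpha>"
            using True a powr_mono2[of \<alpha> "z $ j powr (1 / \<alpha>)" "x $ j"]
              powr_less_mono2[of \<alpha> "x $ j" "z $ j powr (1 / \<alpha>)"]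
            by (metis less_imp_le not_le powr_ge_zero)
          then show ?thesis using True a elim[rule_format, of j] by (simp add: powr_powr)
        next
          case False
          have "0 < z $ j powr (1 / \<alpha>)" using elim[rule_format, of j] by simp
          with False show ?thesis by linarith
        qed
        then show ?case by (auto simp: power_map_def less_eq_vec_def)
      qed
      have "power_map \<alpha> -` {..x} \<inter> space borel \<in> sets borel" by measurable
      then show "{z. power_map \<alpha> z \<le> x} \<in> Z.events" by (simp add: vimage_def)
    qed auto
    also have "\<dots> = max_stable_df H \<alpha> x"
      using max_stable_df_eq_simple[of x \<alpha>] by (auto simp: max_stable_df_def)
    finally show ?thesis .
  qed
  then show "is_law_of (distr simple_law borel (power_map \<alpha>)) (max_stable_df H \<alpha>)"
    by (auto simp: is_law_of_def intro!: Z.prob_space_distr)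
qed

section \<open>Kolmogorov distance\<close>

lemma max_stable_df_bounds: "0 \<le> max_stable_df H \<alpha> x" "max_stable_df H \<alpha> x \<le> 1"
  using stdf_nonneg[of "\<chi> j. x $ j powr (- \<alpha>)"] by (auto simp: max_stable_df_def)

lemma max_stable_df_diff_le_1: "\<bar>max_stable_df H \<alpha>1 x - max_stable_df H \<alpha>2 x\<bar> \<le> 1"
  using max_stable_df_bounds[of \<alpha>1 x] max_stable_df_bounds[of \<alpha>2 x] by linarith

lemma max_stable_df_diff_le_kolmogorov:
  "\<bar>max_stable_df H \<alpha>1 x - max_stable_df H \<alpha>2 x\<bar>
    \<le> kolmogorov_dist (max_stable_df H \<alpha>1) (max_stable_df H \<alpha>2)"
  unfolding kolmogorov_dist_def
  by (rule cSUP_upper) (auto intro!: bdd_aboveI2[of _ _ 1] max_stable_df_diff_le_1)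

lemma eta_le_kolmogorov_dist:
  assumes "0 < \<alpha>1" "0 < \<alpha>2"
  shows "eta \<alpha>1 \<alpha>2 \<le> kolmogorov_dist (max_stable_df H \<alpha>1) (max_stable_df H \<alpha>2)"
  unfolding eta_def
proof (rule cSUP_least)
  fix q :: real assume "q \<in> {0<..}"
  then have q: "0 < q" by simp
  let ?y = "\<lambda>n. \<chi> i :: 'd. if i = undefined then 1 / q else real (Suc n)"
  have "(\<lambda>n. max_stable_df H \<alpha> (?y n)) \<longlonglongrightarrow> exp (- (q powr \<alpha>))" if "0 < \<alpha>" for \<alpha>
  proof -
    have "(1 / q) powr (- \<alpha>) = q powr \<alpha>"
      using q by (simp add: powr_minus_divide powr_divide)
    then show ?thesis
      using max_stable_df_margin_limit[of "1 / q" \<alpha> undefined] q that by simp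
  qed
  then have "(\<lambda>n. \<bar>max_stable_df H \<alpha>1 (?y n) - max_stable_df H \<alpha>2 (?y n)\<bar>)
      \<longlonglongrightarrow> \<bar>exp (- (q powr \<alpha>1)) - exp (- (q powr \<alpha>2))\<bar>"
    using assms by (intro tendsto_intros) auto
  then show "\<bar>exp (- (q powr \<alpha>1)) - exp (- (q powr \<alpha>2))\<bar>
      \<le> kolmogorov_dist (max_stable_df H \<alpha>1) (max_stable_df H \<alpha>2)"
    by (rule LIMSEQ_le_const2) (auto intro: max_stable_df_diff_le_kolmogorov)
qed auto

text \<open>
  The event \<open>Z \<le> a\<close> without \<open>Z \<le> b\<close> forces \<open>b\<^sub>j < Z\<^sub>j \<le> a\<^sub>j\<close> for some \<open>j\<close>.
\<close>

lemma prob_atMost_diff_le: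
  assumes a: "\<And>j. 0 < a $ j" and b: "\<And>j. 0 < b $ j"
  shows "Z.prob {..a} - Z.prob {..b} \<le> (\<Sum>j\<in>UNIV. \<bar>exp (- (1 / a $ j)) - exp (- (1 / b $ j))\<bar>)"
proof -
  let ?D = "\<lambda>j. {z. z $ j \<le> a $ j} - {z. z $ j \<le> b $ j}"
  have D: "?D j \<in> Z.events" for j by measurable
  have "Z.prob {..a} \<le> Z.prob ({..b} \<union> (\<Union>j. ?D j))"
    using D by (intro Z.finite_measure_mono) (auto simp: less_eq_vec_def)
  also have "\<dots> \<le> Z.prob {..b} + Z.prob (\<Union>j. ?D j)"
    using D by (intro measure_Un_le) auto
  also have "Z.prob (\<Union>j. ?D j) \<le> (\<Sum>j\<in>UNIV. Z.prob (?D j))"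
    using D by (intro Z.finite_measure_subadditive_finite) auto
  also have "\<dots> \<le> (\<Sum>j\<in>UNIV. \<bar>exp (- (1 / a $ j)) - exp (- (1 / b $ j))\<bar>)"
  proof (rule sum_mono)
    fix j
    show "Z.prob (?D j) \<le> \<bar>exp (- (1 / a $ j)) - exp (- (1 / b $ j))\<bar>"
    proof (cases "a $ j \<le> b $ j")
      case True
      then have "?D j = {}" by auto
      then show ?thesis by (simp only: measure_empty abs_ge_zero)
    next
      case False
      then have "Z.prob (?D j) = Z.prob {z. z $ j \<le> a $ j} - Z.prob {z. z $ j \<le> b $ j}"
        by (intro Z.finite_measure_Diff) auto
      then show ?thesis by (simp add: simple_law_margin_pos a b)
    qed
  qed
  finally show ?thesis by simp
qed

end

lemma eta_upper:
  assumes "0 < q"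
  shows "\<bar>exp (- (q powr \<alpha>1)) - exp (- (q powr \<alpha>2))\<bar> \<le> eta \<alpha>1 \<alpha>2"
  unfolding eta_def
proof (rule cSUP_upper)
  show "bdd_above ((\<lambda>q. \<bar>exp (- (q powr \<alpha>1)) - exp (- (q powr \<alpha>2))\<bar>) ` {0<..})"
  proof (rule bdd_aboveI2)
    fix q :: real
    have "0 < exp (- (q powr \<alpha>))" "exp (- (q powr \<alpha>)) \<le> 1" for \<alpha> by auto
    from this[of \<alpha>1] this[of \<alpha>2]
    show "\<bar>exp (- (q powr \<alpha>1)) - exp (- (q powr \<alpha>2))\<bar> \<le> 1" by linarith
  qed
qed (use assms in simp)

lemma C0_upper:
  assumes "0 < z"
  shows "z * exp (- z) * \<bar>ln z\<bar> \<le> C0"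
  unfolding C0_def
proof (rule cSUP_upper)
  show "bdd_above ((\<lambda>z :: real. z * exp (- z) * \<bar>ln z\<bar>) ` {0<..})"
  proof (rule bdd_aboveI2)
    fix z :: real assume "z \<in> {0<..}"
    then have z: "0 < z" by simp
    show "z * exp (- z) * \<bar>ln z\<bar> \<le> 2"
    proof (cases "1 \<le> z")
      case True
      have "1 + z + z\<^sup>2 / 2 \<le> exp z" by (rule exp_lower_Taylor_quadratic) (use z in simp)
      then have "z * z \<le> 2 * exp z" using z by (simp add: power2_eq_square)
      moreover have "z * \<bar>ln z\<bar> \<le> z * z"
        using True ln_le_minus_one[OF z] by (intro mult_left_mono) auto
      ultimately have "z * \<bar>ln z\<bar> \<le> 2 * exp z" by linarith
      then show ?thesis by (simp add: exp_minus field_simps)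
    next
      case False
      have "ln (1 / z) \<le> 1 / z - 1" by (rule ln_le_minus_one) (use z in simp)
      then have "\<bar>ln z\<bar> \<le> 1 / z" using False z by (simp add: ln_div)
      then have "z * \<bar>ln z\<bar> \<le> 1" using z by (simp add: field_simps)
      then have "exp (- z) * (z * \<bar>ln z\<bar>) \<le> 1 * 1"
        using z by (intro mult_mono) auto
      then show ?thesis by (simp add: mult_ac)
    qed
  qed
qed (use assms in simp)

text \<open>
  With \<open>z = q powr x\<close>, the derivative of \<open>exp (- (q powr x))\<close> in \<open>x\<close> is
  \<open>- z exp (- z) ln z / x\<close>, because \<open>ln q = ln z / x\<close>.
\<close>

lemma eta_le_C0:
  assumes a: "0 < \<alpha>1" "0 < \<alpha>2"
  shows "eta \<alpha>1 \<alpha>2 \<le> C0 / min \<alpha>1 \<alpha>2 * \<bar>\<alpha>1 - \<alpha>2\<bar>"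
  unfolding eta_def
proof (rule cSUP_least)
  fix q :: real assume "q \<in> {0<..}"
  then have q: "0 < q" by simp
  have C0: "0 \<le> C0" using C0_upper[of 1] by simp
  have main: "\<bar>exp (- (q powr a)) - exp (- (q powr b))\<bar> \<le> C0 / a * (b - a)"
    if ab: "0 < a" "a < b" for a b
  proof -
    have "((\<lambda>x. exp (- (q powr x))) has_real_derivative
        - (exp (- (q powr x)) * (q powr x * ln q))) (at x)" for x
      using q by (auto intro!: derivative_eq_intros)
    then obtain x where x: "a < x" "x < b" and
      eq: "exp (- (q powr b)) - exp (- (q powr a))
        = (b - a) * - (exp (- (q powr x)) * (q powr x * ln q))"
      using MVT2[OF ab(2), of "\<lambda>x. exp (- (q powr x))"
          "\<lambda>x. - (exp (- (q powr x)) * (q powr x * ln q))"] by blast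
    let ?z = "q powr x"
    have "\<bar>exp (- (q powr a)) - exp (- (q powr b))\<bar> = (b - a) * (?z * exp (- ?z) * \<bar>ln ?z\<bar> / x)"
      using eq q x ab by (simp add: abs_minus_commute[of "exp (- (q powr a))"] abs_mult ln_powr mult_ac)
    also have "\<dots> \<le> (b - a) * (C0 / a)"
      using ab x q C0_upper[of ?z] C0 by (intro mult_left_mono frac_le) auto
    finally show ?thesis by (simp add: mult.commute)
  qed
  show "\<bar>exp (- (q powr \<alpha>1)) - exp (- (q powr \<alpha>2))\<bar> \<le> C0 / min \<alpha>1 \<alpha>2 * \<bar>\<alpha>1 - \<alpha>2\<bar>"
    using main[of \<alpha>1 \<alpha>2] main[of \<alpha>2 \<alpha>1] a
    by (cases \<alpha>1 \<alpha>2 rule: linorder_cases) (auto simp: abs_minus_commute min_def)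
qed auto

context spectral_measure
begin

lemma max_stable_df_diff_le:
  assumes a: "0 < \<alpha>1" "0 < \<alpha>2"
  shows "\<bar>max_stable_df H \<alpha>1 x - max_stable_df H \<alpha>2 x\<bar> \<le> real CARD('d) * eta \<alpha>1 \<alpha>2"
proof (cases "\<forall>j. 0 < x $ j")
  case False
  then show ?thesis using eta_upper[of 1 \<alpha>1 \<alpha>2] by (auto simp: max_stable_df_def)
next
  case True
  let ?a = "\<lambda>\<alpha>. \<chi> j. x $ j powr \<alpha>"
  have pos: "0 < ?a \<alpha> $ j" for \<alpha> j using True by simp (metis less_irrefl)
  have inv: "1 / x $ j powr \<alpha> = (1 / x $ j) powr \<alpha>" for \<alpha> j
    using True by (simp add: powr_divide less_imp_le)
  have half: "max_stable_df H \<alpha> x - max_stable_df H \<beta> x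
      \<le> (\<Sum>j\<in>UNIV. \<bar>exp (- ((1 / x $ j) powr \<alpha>)) - exp (- ((1 / x $ j) powr \<beta>))\<bar>)" for \<alpha> \<beta>
    using prob_atMost_diff_le[of "?a \<alpha>" "?a \<beta>", OF pos pos] True
    by (simp add: max_stable_df_eq_simple inv)
  have "\<bar>max_stable_df H \<alpha>1 x - max_stable_df H \<alpha>2 x\<bar>
      \<le> (\<Sum>j\<in>UNIV. \<bar>exp (- ((1 / x $ j) powr \<alpha>1)) - exp (- ((1 / x $ j) powr \<alpha>2))\<bar>)"
    using half[of \<alpha>1 \<alpha>2] half[of \<alpha>2 \<alpha>1] by (simp add: abs_minus_commute abs_le_iff)
  also have "\<dots> \<le> (\<Sum>j\<in>(UNIV :: 'd set). eta \<alpha>1 \<alpha>2)"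
    using True by (intro sum_mono eta_upper) simp
  finally show ?thesis by simp
qed

lemma kolmogorov_dist_le:
  assumes a: "0 < \<alpha>1" "0 < \<alpha>2"
  shows "kolmogorov_dist (max_stable_df H \<alpha>1) (max_stable_df H \<alpha>2)
    \<le> min 1 (real CARD('d) * eta \<alpha>1 \<alpha>2)"
  unfolding kolmogorov_dist_def
  using max_stable_df_diff_le_1 max_stable_df_diff_le[OF a] by (intro cSUP_least) auto

lemma kolmogorov_dist_le_C0:
  assumes a: "0 < \<alpha>1" "0 < \<alpha>2"
  shows "kolmogorov_dist (max_stable_df H \<alpha>1) (max_stable_df H \<alpha>2)
    \<le> min 1 (real CARD('d) * C0 / min \<alpha>1 \<alpha>2 * \<bar>\<alpha>1 - \<alpha>2\<bar>)"
proof -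
  have "real CARD('d) * eta \<alpha>1 \<alpha>2 \<le> real CARD('d) * C0 / min \<alpha>1 \<alpha>2 * \<bar>\<alpha>1 - \<alpha>2\<bar>"
    using mult_left_mono[OF eta_le_C0[OF a], of "real CARD('d)"] by simp
  then show ?thesis using kolmogorov_dist_le[OF a] by linarith
qed

end

section \<open>Wasserstein distance\<close>

text \<open>
  A substitute for Minkowski's inequality: it has the same sharp constant when all summands
  have the same \<open>p\<close>-th moment. Convexity of the power is applied to the positive summands only.
\<close>

lemma sum_powr_le:
  fixes a :: "'i \<Rightarrow> real"
  assumes I: "finite I" and a: "\<And>i. i \<in> I \<Longrightarrow> 0 \<le> a i" and p: "1 \<le> p"
  shows "(\<Sum>i\<in>I. a i) powr p \<le> real (card I) powr (p - 1) * (\<Sum>i\<in>I. a i powr p)"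
proof -
  define J where "J = {i \<in> I. 0 < a i}"
  have J: "finite J" "J \<subseteq> I" using I by (auto simp: J_def)
  have rest: "a i = 0" if "i \<in> I - J" for i using a that by (force simp: J_def)
  have sums: "(\<Sum>i\<in>I. a i) = (\<Sum>i\<in>J. a i)" "(\<Sum>i\<in>I. a i powr p) = (\<Sum>i\<in>J. a i powr p)"
    using I J rest by (auto intro!: sum.mono_neutral_right)
  show ?thesis
  proof (cases "J = {}")
    case True then show ?thesis by (simp add: sums)
  next
    case False
    let ?n = "real (card J)"
    have n: "0 < ?n" using J False by (simp add: card_gt_0_iff)
    have "(\<Sum>i\<in>J. (1 / ?n) *\<^sub>R a i) powr p \<le> (\<Sum>i\<in>J. (1 / ?n) * a i powr p)"
      using J False n by (intro convex_on_sum[OF _ _ powr_convex[OF p]]) (auto simp: J_def)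
    then have "((\<Sum>i\<in>J. a i) / ?n) powr p \<le> (\<Sum>i\<in>J. a i powr p) / ?n"
      by (simp add: sum_divide_distrib)
    then have "?n powr p * ((\<Sum>i\<in>J. a i) / ?n) powr p \<le> ?n powr p * ((\<Sum>i\<in>J. a i powr p) / ?n)"
      by (intro mult_left_mono) auto
    moreover have "?n powr p * ((\<Sum>i\<in>J. a i) / ?n) powr p = (\<Sum>i\<in>J. a i) powr p"
      using n a J by (simp add: powr_divide sum_nonneg subset_iff)
    moreover have "?n powr p * ((\<Sum>i\<in>J. a i powr p) / ?n) = ?n powr (p - 1) * (\<Sum>i\<in>J. a i powr p)"
      using n by (simp add: powr_diff)
    moreover have "?n powr (p - 1) * (\<Sum>i\<in>J. a i powr p) \<le> real (card I) powr (p - 1) * (\<Sum>i\<in>J. a i powr p)"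
      using I J p card_mono[OF I J(2)]
      by (intro mult_right_mono powr_mono2 sum_nonneg) auto
    ultimately show ?thesis by (simp add: sums)
  qed
qed

text \<open>Finiteness matters, as the Bochner integral of a nonintegrable function is \<open>0\<close>.\<close>

lemma set_integral_exp_law:
  assumes [measurable]: "f \<in> borel_measurable borel" and f: "\<And>t. 0 \<le> f t"
    and fin: "(\<integral>\<^sup>+t. ennreal (f t) \<partial>exp_law) < \<infinity>"
  shows "ennreal (LBINT t:{0<..}. f t * exp (- t)) = (\<integral>\<^sup>+t. ennreal (f t) \<partial>exp_law)"
proof -
  have "(\<integral>\<^sup>+t. ennreal (f t) \<partial>exp_law)
      = (\<integral>\<^sup>+t. ennreal (indicator {0<..} t * (f t * exp (- t))) \<partial>lborel)"
    by (subst nn_integral_exp_law)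
      (auto simp: f ennreal_mult'[symmetric] indicator_def intro!: nn_integral_cong)
  moreover have "(LBINT t:{0<..}. f t * exp (- t))
      = enn2real (\<integral>\<^sup>+t. ennreal (indicator {0<..} t * (f t * exp (- t))) \<partial>lborel)"
    unfolding set_lebesgue_integral_def real_scaleR_def
    by (rule integral_eq_nn_integral) (auto simp: f)
  ultimately show ?thesis using fin by simp
qed

lemma exp_law_moment_finite:
  assumes "\<beta> < 1"
  shows "(\<integral>\<^sup>+t. ennreal (t powr (- \<beta>)) \<partial>exp_law) < \<infinity>"
proof -
  have "(\<integral>\<^sup>+t. ennreal (t powr (- \<beta>)) \<partial>exp_law)
      \<le> (\<integral>\<^sup>+t. ennreal (indicator {0..} t * t powr ((1 - \<beta>) - 1) / exp t) \<partial>lborel)"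
    by (subst nn_integral_exp_law)
      (auto simp: indicator_def ennreal_mult'[symmetric] exp_minus field_simps intro!: nn_integral_mono)
  also have "\<dots> = ennreal (Gamma (1 - \<beta>))"
    using assms by (intro Gamma_conv_nn_integral_real[symmetric]) simp
  finally show ?thesis by (auto intro: le_less_trans)
qed

lemma exp_law_diff_moment_finite:
  assumes p: "0 < p" "p * \<beta>1 < 1" "p * \<beta>2 < 1"
  shows "(\<integral>\<^sup>+t. ennreal (\<bar>t powr (- \<beta>1) - t powr (- \<beta>2)\<bar> powr p) \<partial>exp_law) < \<infinity>"
proof -
  have le: "\<bar>a - b\<bar> powr p \<le> a powr p + b powr p" if "0 \<le> a" "0 \<le> b" for a b :: real
  proof -
    have "\<bar>a - b\<bar> powr p \<le> (max a b) powr p" using p that by (intro powr_mono2) auto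
    also have "\<dots> \<le> a powr p + b powr p" by (simp add: max_def)
    finally show ?thesis .
  qed
  have "(\<integral>\<^sup>+t. ennreal (\<bar>t powr (- \<beta>1) - t powr (- \<beta>2)\<bar> powr p) \<partial>exp_law)
      \<le> (\<integral>\<^sup>+t. ennreal (t powr (- (p * \<beta>1))) + ennreal (t powr (- (p * \<beta>2))) \<partial>exp_law)"
    using le[of "t powr (- \<beta>1)" "t powr (- \<beta>2)" for t]
    by (intro nn_integral_mono) (simp add: powr_powr ennreal_plus[symmetric] mult.commute del: ennreal_plus)
  also have "\<dots> = (\<integral>\<^sup>+t. ennreal (t powr (- (p * \<beta>1))) \<partial>exp_law)
      + (\<integral>\<^sup>+t. ennreal (t powr (- (p * \<beta>2))) \<partial>exp_law)"
    by (rule nn_integral_add) auto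
  also have "\<dots> < \<infinity>"
    using exp_law_moment_finite[OF p(2)] exp_law_moment_finite[OF p(3)] by simp
  finally show ?thesis .
qed

text \<open>
  Both \<open>t powr (- a)\<close> and \<open>t powr (- b)\<close> lie on the same side of \<open>1\<close>, the one with the larger
  exponent at least as far away. Hence their distance is a difference of the single function
  \<open>\<bar>x - 1\<bar>\<close> at the two points.
\<close>

lemma abs_powr_diff_eq:
  fixes t :: real
  assumes "0 < t" "b \<le> a" "0 \<le> b"
  shows "\<bar>t powr (- a) - 1\<bar> = \<bar>t powr (- a) - t powr (- b)\<bar> + \<bar>t powr (- b) - 1\<bar>"
proof (cases "1 \<le> t")
  case True
  have "t powr (- a) \<le> t powr (- b)" "t powr (- b) \<le> t powr 0"
    using True assms by (intro powr_mono; simp)+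
  then show ?thesis using assms by simp
next
  case False
  have "t powr (- b) \<le> t powr (- a)" "t powr 0 \<le> t powr (- b)"
    using False assms by (intro powr_mono'; simp)+
  then show ?thesis using assms by simp
qed

text \<open>
  Kantorovich duality with the test function \<open>\<bar>x - 1\<bar>\<close>. The hypothesis on \<open>K\<close> involves only
  the laws of \<open>X\<close> and \<open>Y\<close>, not their coupling.
\<close>

lemma coupling_cost_ge:
  fixes X Y :: "'a \<Rightarrow> real"
  assumes [measurable]: "X \<in> borel_measurable M" "Y \<in> borel_measurable M"
    and eq: "(\<integral>\<^sup>+w. ennreal \<bar>X w - 1\<bar> \<partial>M) = K + (\<integral>\<^sup>+w. ennreal \<bar>Y w - 1\<bar> \<partial>M)"
    and fin: "(\<integral>\<^sup>+w. ennreal \<bar>Y w - 1\<bar> \<partial>M) < \<infinity>" (is "?B < \<infinity>")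
  shows "K \<le> (\<integral>\<^sup>+w. ennreal \<bar>X w - Y w\<bar> \<partial>M)"
proof -
  have "(\<integral>\<^sup>+w. ennreal \<bar>X w - 1\<bar> \<partial>M) \<le> (\<integral>\<^sup>+w. ennreal \<bar>X w - Y w\<bar> + ennreal \<bar>Y w - 1\<bar> \<partial>M)"
    by (intro nn_integral_mono) (simp add: ennreal_plus[symmetric] del: ennreal_plus)
  also have "\<dots> = (\<integral>\<^sup>+w. ennreal \<bar>X w - Y w\<bar> \<partial>M) + (\<integral>\<^sup>+w. ennreal \<bar>Y w - 1\<bar> \<partial>M)"
    by (rule nn_integral_add) auto
  finally have "?B + K \<le> ?B + (\<integral>\<^sup>+w. ennreal \<bar>X w - Y w\<bar> \<partial>M)"
    unfolding eq by (simp only: add.commute)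
  then show ?thesis
    using fin by (auto simp: ennreal_add_left_cancel_le)
qed

lemma ennreal_root_le:
  assumes p: "0 < p" and x: "x \<le> ennreal (a powr p)" and a: "0 \<le> a"
  shows "ennreal_root p x \<le> ennreal a"
proof -
  have "x \<noteq> \<infinity>" using x by (auto simp: top.extremum_unique)
  moreover have "enn2real x \<le> a powr p" using x by (intro enn2real_leI) auto
  then have "enn2real x powr (1 / p) \<le> (a powr p) powr (1 / p)"
    using p by (intro powr_mono2) auto
  then have "enn2real x powr (1 / p) \<le> a" using p a by (simp add: powr_powr)
  ultimately show ?thesis by (simp add: ennreal_root_def ennreal_leI)
qed

lemma ennreal_root_1: "ennreal_root 1 x = x"
  by (simp add: ennreal_root_def less_top)

lemma measurable_fst_snd_borel [measurable]:
  "fst \<in> borel_measurable (borel :: ((real ^ 'd::finite) \<times> (real ^ 'd)) measure)"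
  "snd \<in> borel_measurable (borel :: ((real ^ 'd::finite) \<times> (real ^ 'd)) measure)"
  by (auto intro!: borel_measurable_continuous_onI continuous_intros)

lemma l1_norm_measurable [measurable]: "l1_norm \<in> borel_measurable (borel :: (real ^ 'd::finite) measure)"
  unfolding l1_norm_def by measurable

context spectral_measure
begin

lemma power_coupling_in_couplings:
  assumes a: "0 < \<alpha>1" "0 < \<alpha>2"
  shows "distr simple_law borel (\<lambda>z. (power_map \<alpha>1 z, power_map \<alpha>2 z))
    \<in> couplings (law_of (max_stable_df H \<alpha>1)) (law_of (max_stable_df H \<alpha>2))"
proof -
  have [measurable]: "(\<lambda>z. (power_map \<alpha>1 z, power_map \<alpha>2 z)) \<in> simple_law \<rightarrow>\<^sub>M borel"
    by (rule borel_measurable_Pair) measurable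
  show ?thesis
    by (auto simp: couplings_def law_of_max_stable_df a distr_distr o_def intro!: Z.prob_space_distr)
qed

lemma wasserstein_le:
  assumes p: "1 \<le> p" "p < \<alpha>1" "p < \<alpha>2"
  shows "wasserstein_l1 p (law_of (max_stable_df H \<alpha>1)) (law_of (max_stable_df H \<alpha>2))
    \<le> ennreal (real CARD('d) * m_exp p (1 / \<alpha>1) (1 / \<alpha>2))"
proof -
  let ?d = "real CARD('d)"
  let ?f = "\<lambda>z. \<bar>z powr (1 / \<alpha>1) - z powr (1 / \<alpha>2)\<bar> powr p"
  let ?g = "\<lambda>t. \<bar>t powr (- (1 / \<alpha>1)) - t powr (- (1 / \<alpha>2))\<bar> powr p"
  let ?K = "LBINT t:{0<..}. ?g t * exp (- t)"
  let ?\<pi> = "distr simple_law borel (\<lambda>z. (power_map \<alpha>1 z, power_map \<alpha>2 z))"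
  have a: "0 < \<alpha>1" "0 < \<alpha>2" using p by auto
  have [measurable]: "(\<lambda>z. (power_map \<alpha>1 z, power_map \<alpha>2 z)) \<in> simple_law \<rightarrow>\<^sub>M borel"
    by (rule borel_measurable_Pair) measurable
  have K: "ennreal ?K = (\<integral>\<^sup>+t. ennreal (?g t) \<partial>exp_law)"
    using p a by (intro set_integral_exp_law exp_law_diff_moment_finite) auto
  have K0: "0 \<le> ?K"
    unfolding set_lebesgue_integral_def by (intro integral_nonneg_AE) auto
  have margin: "(\<integral>\<^sup>+z. ennreal (?f (z $ j)) \<partial>simple_law) = ennreal ?K" for j
  proof -
    have "(\<integral>\<^sup>+z. ennreal (?f (z $ j)) \<partial>simple_law) = (\<integral>\<^sup>+t. ennreal (?f (1 / t)) \<partial>exp_law)"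
      by (rule nn_integral_simple_law_margin) measurable
    also have "\<dots> = (\<integral>\<^sup>+t. ennreal (?g t) \<partial>exp_law)"
      using exp_law_AE_pos
      by (intro nn_integral_cong_AE) (auto simp: powr_divide powr_minus_divide elim!: eventually_mono)
    finally show ?thesis by (simp add: K)
  qed
  have "(\<integral>\<^sup>+(x, y). ennreal (l1_norm (x - y) powr p) \<partial>?\<pi>)
      = (\<integral>\<^sup>+z. ennreal (l1_norm (power_map \<alpha>1 z - power_map \<alpha>2 z) powr p) \<partial>simple_law)"
    by (subst nn_integral_distr) (auto simp: case_prod_beta)
  also have "\<dots> \<le> (\<integral>\<^sup>+z. ennreal (?d powr (p - 1)) * (\<Sum>j\<in>UNIV. ennreal (?f (z $ j))) \<partial>simple_law)"
  proof (intro nn_integral_mono)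
    fix z
    have "l1_norm (power_map \<alpha>1 z - power_map \<alpha>2 z) powr p \<le> ?d powr (p - 1) * (\<Sum>j\<in>UNIV. ?f (z $ j))"
      unfolding l1_norm_def using p
      by (intro order_trans[OF sum_powr_le]) (auto simp: power_map_def)
    then show "ennreal (l1_norm (power_map \<alpha>1 z - power_map \<alpha>2 z) powr p)
        \<le> ennreal (?d powr (p - 1)) * (\<Sum>j\<in>UNIV. ennreal (?f (z $ j)))"
      by (simp add: ennreal_mult'[symmetric] ennreal_leI)
  qed
  also have "\<dots> = ennreal (?d powr (p - 1)) * (\<Sum>j\<in>(UNIV :: 'd set). ennreal ?K)"
    by (subst nn_integral_cmult, measurable) (subst nn_integral_sum, measurable, simp only: margin)
  also have "\<dots> = ennreal (?d powr (p - 1) * (?d * ?K))"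
    using K0 by (simp add: ennreal_of_nat_eq_real_of_nat ennreal_mult'[symmetric])
  also have "?d powr (p - 1) * (?d * ?K) = (?d * ?K powr (1 / p)) powr p"
    using p K0 by (simp add: powr_mult powr_powr powr_diff)
  finally have "ennreal_root p (\<integral>\<^sup>+(x, y). ennreal (l1_norm (x - y) powr p) \<partial>?\<pi>)
      \<le> ennreal (?d * ?K powr (1 / p))"
    using p by (intro ennreal_root_le) auto
  then have "ennreal_root p (\<integral>\<^sup>+(x, y). ennreal (l1_norm (x - y) powr p) \<partial>?\<pi>)
      \<le> ennreal (?d * m_exp p (1 / \<alpha>1) (1 / \<alpha>2))"
    by (simp add: m_exp_def)
  then show ?thesis
    unfolding wasserstein_l1_def by (rule INF_lower2[OF power_coupling_in_couplings[OF a]])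
qed

lemma coupling_coordinate_cost_ge:
  assumes a: "1 < \<alpha>1" "1 < \<alpha>2"
    and \<pi>: "\<pi> \<in> couplings (law_of (max_stable_df H \<alpha>1)) (law_of (max_stable_df H \<alpha>2))"
  shows "(\<integral>\<^sup>+t. ennreal \<bar>t powr (- (1 / \<alpha>1)) - t powr (- (1 / \<alpha>2))\<bar> \<partial>exp_law)
    \<le> (\<integral>\<^sup>+w. ennreal \<bar>fst w $ j - snd w $ j\<bar> \<partial>\<pi>)" (is "?K \<le> _")
proof -
  have sets [measurable_cong]: "sets \<pi> = sets borel"
    and m: "distr \<pi> borel fst = distr simple_law borel (power_map \<alpha>1)"
      "distr \<pi> borel snd = distr simple_law borel (power_map \<alpha>2)"
    using \<pi> a by (auto simp: couplings_def law_of_max_stable_df)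
  let ?I = "\<lambda>\<alpha>. \<integral>\<^sup>+t. ennreal \<bar>t powr (- (1 / \<alpha>)) - 1\<bar> \<partial>exp_law"
  have I: "(\<integral>\<^sup>+x. ennreal \<bar>x $ j - 1\<bar> \<partial>distr simple_law borel (power_map \<alpha>)) = ?I \<alpha>" for \<alpha>
  proof -
    have "(\<integral>\<^sup>+x. ennreal \<bar>x $ j - 1\<bar> \<partial>distr simple_law borel (power_map \<alpha>))
        = (\<integral>\<^sup>+z. ennreal \<bar>(z $ j) powr (1 / \<alpha>) - 1\<bar> \<partial>simple_law)"
      by (subst nn_integral_distr) (auto simp: power_map_def)
    also have "\<dots> = (\<integral>\<^sup>+t. ennreal \<bar>(1 / t) powr (1 / \<alpha>) - 1\<bar> \<partial>exp_law)"
      by (rule nn_integral_simple_law_margin) measurable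
    also have "\<dots> = ?I \<alpha>"
      using exp_law_AE_pos
      by (intro nn_integral_cong_AE) (auto simp: powr_divide powr_minus_divide elim!: eventually_mono)
    finally show ?thesis .
  qed
  have X: "(\<integral>\<^sup>+w. ennreal \<bar>fst w $ j - 1\<bar> \<partial>\<pi>) = ?I \<alpha>1"
    using I[of \<alpha>1] unfolding m(1)[symmetric] by (subst (asm) nn_integral_distr) auto
  have Y: "(\<integral>\<^sup>+w. ennreal \<bar>snd w $ j - 1\<bar> \<partial>\<pi>) = ?I \<alpha>2"
    using I[of \<alpha>2] unfolding m(2)[symmetric] by (subst (asm) nn_integral_distr) auto
  have fin: "?I \<alpha> < \<infinity>" if "1 < \<alpha>" for \<alpha>
  proof -
    have "?I \<alpha> = (\<integral>\<^sup>+t. ennreal (\<bar>t powr (- (1 / \<alpha>)) - t powr (- 0)\<bar> powr 1) \<partial>exp_law)"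
      using exp_law_AE_pos by (intro nn_integral_cong_AE) (auto elim!: eventually_mono)
    also have "\<dots> < \<infinity>"
      using that by (intro exp_law_diff_moment_finite) auto
    finally show ?thesis .
  qed
  have split: "?I \<alpha> = (\<integral>\<^sup>+t. ennreal \<bar>t powr (- (1 / \<alpha>)) - t powr (- (1 / \<beta>))\<bar> \<partial>exp_law) + ?I \<beta>"
    if "0 < \<alpha>" "\<alpha> \<le> \<beta>" for \<alpha> \<beta>
  proof -
    have "?I \<alpha> = (\<integral>\<^sup>+t. ennreal \<bar>t powr (- (1 / \<alpha>)) - t powr (- (1 / \<beta>))\<bar>
        + ennreal \<bar>t powr (- (1 / \<beta>)) - 1\<bar> \<partial>exp_law)"
    proof (rule nn_integral_cong_AE)
      show "AE t in exp_law. ennreal \<bar>t powr (- (1 / \<alpha>)) - 1\<bar>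
          = ennreal \<bar>t powr (- (1 / \<alpha>)) - t powr (- (1 / \<beta>))\<bar>
            + ennreal \<bar>t powr (- (1 / \<beta>)) - 1\<bar>"
        using exp_law_AE_pos
      proof eventually_elim
        case (elim t)
        show ?case
          using abs_powr_diff_eq[OF elim, of "1 / \<beta>" "1 / \<alpha>"] that
          by (simp add: frac_le ennreal_plus[symmetric] del: ennreal_plus)
      qed
    qed
    also have "\<dots> = (\<integral>\<^sup>+t. ennreal \<bar>t powr (- (1 / \<alpha>)) - t powr (- (1 / \<beta>))\<bar> \<partial>exp_law) + ?I \<beta>"
      by (rule nn_integral_add) auto
    finally show ?thesis .
  qed
  show ?thesis
  proof (cases "\<alpha>1 \<le> \<alpha>2")
    case True
    show ?thesis
    proof (rule coupling_cost_ge)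
      show "(\<integral>\<^sup>+w. ennreal \<bar>fst w $ j - 1\<bar> \<partial>\<pi>) = ?K + (\<integral>\<^sup>+w. ennreal \<bar>snd w $ j - 1\<bar> \<partial>\<pi>)"
        unfolding X Y using split[of \<alpha>1 \<alpha>2] a True by simp
      show "(\<integral>\<^sup>+w. ennreal \<bar>snd w $ j - 1\<bar> \<partial>\<pi>) < \<infinity>"
        unfolding Y using fin a by simp
    qed measurable
  next
    case False
    have "?K \<le> (\<integral>\<^sup>+w. ennreal \<bar>snd w $ j - fst w $ j\<bar> \<partial>\<pi>)"
    proof (rule coupling_cost_ge)
      have "?K = (\<integral>\<^sup>+t. ennreal \<bar>t powr (- (1 / \<alpha>2)) - t powr (- (1 / \<alpha>1))\<bar> \<partial>exp_law)"
        by (simp add: abs_minus_commute)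
      then show "(\<integral>\<^sup>+w. ennreal \<bar>snd w $ j - 1\<bar> \<partial>\<pi>) = ?K + (\<integral>\<^sup>+w. ennreal \<bar>fst w $ j - 1\<bar> \<partial>\<pi>)"
        unfolding X Y using split[of \<alpha>2 \<alpha>1] a False by simp
      show "(\<integral>\<^sup>+w. ennreal \<bar>fst w $ j - 1\<bar> \<partial>\<pi>) < \<infinity>"
        unfolding X using fin a by simp
    qed measurable
    then show ?thesis by (simp add: abs_minus_commute)
  qed
qed

lemma wasserstein_1_eq:
  assumes a: "1 < \<alpha>1" "1 < \<alpha>2"
  shows "wasserstein_l1 1 (law_of (max_stable_df H \<alpha>1)) (law_of (max_stable_df H \<alpha>2))
    = ennreal (real CARD('d) *
        (LBINT t:{0<..}. \<bar>t powr (- 1 / \<alpha>1) - t powr (- 1 / \<alpha>2)\<bar> * exp (- t)))"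
    (is "?W = ennreal (?d * ?K)")
proof (rule antisym)
  have K0: "0 \<le> ?K"
    unfolding set_lebesgue_integral_def by (intro integral_nonneg_AE) auto
  have "m_exp 1 (1 / \<alpha>1) (1 / \<alpha>2) = ?K"
    using K0 by (simp add: m_exp_def)
  then show "?W \<le> ennreal (?d * ?K)"
    using wasserstein_le[of 1 \<alpha>1 \<alpha>2] a by simp
  have fin: "(\<integral>\<^sup>+t. ennreal \<bar>t powr (- (1 / \<alpha>1)) - t powr (- (1 / \<alpha>2))\<bar> \<partial>exp_law) < \<infinity>"
    using exp_law_diff_moment_finite[of 1 "1 / \<alpha>1" "1 / \<alpha>2"] a by simp
  have K: "ennreal ?K = (\<integral>\<^sup>+t. ennreal \<bar>t powr (- (1 / \<alpha>1)) - t powr (- (1 / \<alpha>2))\<bar> \<partial>exp_law)"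
    using set_integral_exp_law[OF _ _ fin] by simp
  show "ennreal (?d * ?K) \<le> ?W"
    unfolding wasserstein_l1_def
  proof (rule INF_greatest)
    fix \<pi> assume \<pi>: "\<pi> \<in> couplings (law_of (max_stable_df H \<alpha>1)) (law_of (max_stable_df H \<alpha>2))"
    then have [measurable_cong]: "sets \<pi> = sets borel" by (simp add: couplings_def)
    have "ennreal (?d * ?K) = (\<Sum>j\<in>(UNIV :: 'd set). ennreal ?K)"
      using K0 by (simp add: ennreal_mult' ennreal_of_nat_eq_real_of_nat)
    also have "\<dots> \<le> (\<Sum>j\<in>UNIV. \<integral>\<^sup>+w. ennreal \<bar>fst w $ j - snd w $ j\<bar> \<partial>\<pi>)"
      unfolding K by (intro sum_mono coupling_coordinate_cost_ge a \<pi>)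
    also have "\<dots> = (\<integral>\<^sup>+w. (\<Sum>j\<in>UNIV. ennreal \<bar>fst w $ j - snd w $ j\<bar>) \<partial>\<pi>)"
      by (rule nn_integral_sum[symmetric]) measurable
    also have "\<dots> = (\<integral>\<^sup>+(x, y). ennreal (l1_norm (x - y) powr 1) \<partial>\<pi>)"
      by (intro nn_integral_cong) (auto simp: l1_norm_def sum_nonneg)
    finally show "ennreal (?d * ?K)
        \<le> ennreal_root 1 (\<integral>\<^sup>+(x, y). ennreal (l1_norm (x - y) powr 1) \<partial>\<pi>)"
      by (simp only: ennreal_root_1)
  qed
qed

end

lemma spectral_measure_pos_sphere:
  fixes H :: "(real ^ 'd::finite) measure"
  assumes "finite_measure H" and sets: "sets H = sets (restrict_space borel (pos_sphere N))"
    and "\<And>j. (\<integral>s. s $ j \<partial>H) = 1"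
  shows "spectral_measure H"
proof -
  have "(\<lambda>s. s) \<in> borel_measurable (restrict_space borel (pos_sphere N))"
    by (rule measurable_restrict_space1) simp
  then have "(\<lambda>s. s) \<in> borel_measurable H"
    by (simp add: measurable_cong_sets[OF sets refl])
  moreover have "space H = pos_sphere N"
    using sets_eq_imp_space_eq[OF sets] by (simp add: space_restrict_space)
  ultimately show ?thesis
    using assms(1,3) by (simp add: spectral_measure_def spectral_measure_axioms_def pos_sphere_def)
qed

theorem theorem3p5:
  fixes N :: "real ^ 'd::finite \<Rightarrow> real"
    and H :: "(real ^ 'd) measure"
    and \<alpha>1 \<alpha>2 :: real
  assumes "is_norm N"
    and "finite_measure H"
    and "sets H = sets (restrict_space borel (pos_sphere N))"
    and "\<And>j. (\<integral>s. s $ j \<partial>H) = 1"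
    and "0 < \<alpha>1" and "0 < \<alpha>2"
  shows
    "(eta \<alpha>1 \<alpha>2 \<le> kolmogorov_dist (max_stable_df H \<alpha>1) (max_stable_df H \<alpha>2) \<and>
      kolmogorov_dist (max_stable_df H \<alpha>1) (max_stable_df H \<alpha>2)
        \<le> min 1 (real CARD('d) * eta \<alpha>1 \<alpha>2) \<and>
      kolmogorov_dist (max_stable_df H \<alpha>1) (max_stable_df H \<alpha>2)
        \<le> min 1 (real CARD('d) * C0 / min \<alpha>1 \<alpha>2 * \<bar>\<alpha>1 - \<alpha>2\<bar>)) \<and>
     (1 < \<alpha>1 \<and> 1 < \<alpha>2 \<longrightarrow>
      wasserstein_l1 1 (law_of (max_stable_df H \<alpha>1)) (law_of (max_stable_df H \<alpha>2))
        = ennreal (real CARD('d) *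
            (LBINT t:{0<..}. \<bar>t powr (- 1 / \<alpha>1) - t powr (- 1 / \<alpha>2)\<bar> * exp (- t)))) \<and>
     (\<forall>p. 1 \<le> p \<and> p < min \<alpha>1 \<alpha>2 \<longrightarrow>
      wasserstein_l1 p (law_of (max_stable_df H \<alpha>1)) (law_of (max_stable_df H \<alpha>2))
        \<le> ennreal (real CARD('d) * m_exp p (1 / \<alpha>1) (1 / \<alpha>2)))"
proof -
  interpret spectral_measure H
    using assms(2-4) by (rule spectral_measure_pos_sphere)
  show ?thesis
    using eta_le_kolmogorov_dist kolmogorov_dist_le kolmogorov_dist_le_C0 wasserstein_1_eq
      wasserstein_le assms(5,6)
    by simp
qed

end
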